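(* Let $P$ be a graded poset of rank $n$ with a $\hat 0$ and with a generalized CW-labeling (in particular, any CW-labeling) $\lambda$. Let $\chi_P$ be the character of the representation of the $0$-Hecke algebra $H_n(0)$ on $\mathbb C\mathcal M_P$ in which the generator $U_i$ acts by the quadratic exchange $U_i$, and let $\chi_{Q_\lambda(P)}$ be the character of the representation on $\mathbb C\mathcal M_{Q_\lambda(P)}$ transported via the bijection $\varphi$. Then $$ch(\chi_{Q_\lambda(P)})=ch(\chi_P)=F_P(\mathbf x)=\omega F_{Q_\lambda(P)}(\mathbf x).$$
   Context: All posets are finite and graded with minimum $\hat0$; $P$ has rank $n$, i.e. all maximal elements have rank $n$. $\mathcal M_P$ is the set of maximal chains (unrefinable chains from $\hat0$ to a maximal element). C-labelings: a C-labeling assigns to each pair $(\mathbf m,e)$ ($\mathbf m$ a maximal chain, $e$ a cover relation in $\mathbf m$) a label $\lambda(\mathbf m,e)$ in a poset $\Lambda$, such that maximal chains agreeing in their bottom $d$ cover relations have equal labels there (so labels of saturated chains from $\hat0$ are defined). A rooted interval $[x,y]_{\mathbf r}$ is an interval with a saturated chain $\mathbf r$ from $\hat0$ to $x$, a maximal chain $\mathbf c$ of $[x,y]$ being labeled as in $\mathbf r\cup\mathbf c$. Increasing = strictly increasing word of labels; ascent-free = no consecutive labels $a<b$. CR-labeling: every rooted interval has a unique increasing maximal chain. Rank two switching property: for every maximal chain $\mathbf m:\hat0=m_0\lessdot\cdots\lessdot m_n$ and $i<n$ with $\lambda(\mathbf m,m_{i-1}\lessdot m_i)<\lambda(\mathbf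 m,m_i\lessdot m_{i+1})$ there is a unique $m_i'\ne m_i$ such that $\mathbf m'=(\mathbf m\setminus\{m_i\})\cup\{m_i'\}$ is a maximal chain with the same labels except that the two labels at ranks $i,i+1$ are swapped, and $m_i'$ is the same for all maximal chains agreeing with $\mathbf m$ in $m_0,\dots,m_{i+1}$. Then $U_i(\mathbf m):=\mathbf m'$, and $U_i(\mathbf m):=\mathbf m$ if there is no ascent at rank $i$; $U_i$ is likewise defined on saturated chains from $\hat0$. For a rooted interval, two maximal chains are $\sim$-equivalent if connected by a sequence of such exchanges (forwards or backwards). A CW-labeling is a CR-labeling with the rank two switching property such that in each rooted interval distinct ascent-free maximal chains have distinct label words. A generalized CW-labeling is a CR-labeling with the rank two switching property such that (braid) $U_iU_{i+1}U_i(\mathbf c)=U_{i+1}U_iU_{i+1}(\mathbf c)$ whenever the saturated chain $\mathbf c$ from $\hat0$ has strictly increasing labels at ranks $i,i+1,i+2$, and (cancellative) for $z<x<y$, $\mathbf r$ a saturated chain from $\hat0$ to $z$, $\mathbf c$ a maximal chain of $[z,x]$, $\mathbf c_1,\mathbf c_2$ maximal chains of $[x,y]$: $\mathbf c\cup\mathbf c_1\sim\mathbf c\cup\mathbf c_2$ in $[z,y]_{\mathbf r}$ implies $\mathbf c_1\sim\mathbf c_2$ in $[x,y]_{\mathbf r\cup\mathbf c}$. Every CW-labeling is a generalized CW-labeling. $Q_\lambda(P)$: $C(P)$ is the set of saturated chains from $\hat0$ ordered by inclusion, $e(\mathbf c)$ the top element; $\mathbf c_1\sim_\lambda\mathbf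 c_2$ iff $e(\mathbf c_1)=e(\mathbf c_2)=y$ and they are connected by quadratic exchanges among maximal chains of $[\hat0,y]$. $Q_\lambda(P)$ is the set of classes, ordered by the transitive closure of: $X\le Y$ if some $\mathbf c\in X$, $\mathbf d\in Y$ satisfy $\mathbf c\subseteq\mathbf d$. For a class $X$, $e(X)$ is the common top element. The map $\varphi:\mathcal M_{Q_\lambda(P)}\to\mathcal M_P$, $(X_0\lessdot\cdots\lessdot X_n)\mapsto(e(X_0)\lessdot\cdots\lessdot e(X_n))$, is a bijection; the action on $\mathcal M_{Q_\lambda(P)}$ is $\varphi^{-1}U_i\varphi$. $0$-Hecke algebra: $H_n(0)$ is generated by $U_1,\dots,U_{n-1}$ with $U_i^2=U_i$, $U_iU_j=U_jU_i$ for $|i-j|>1$, $U_iU_{i+1}U_i=U_{i+1}U_iU_{i+1}$. Its irreducible representations are one-dimensional, $\psi_S$ for $S\subseteq[n-1]$, with $U_i\mapsto1$ if $i\in S$ and $U_i\mapsto 0$ otherwise, with characters $\chi_S$. The quasisymmetric characteristic is the linear map with $ch(\chi_S)=L_{S,n}$, where $L_{S,n}(\mathbf x)=\sum x_{i_1}\cdots x_{i_n}$ over $1\le i_1\le\cdots\le i_n$ with $i_j<i_{j+1}$ for $j\in S$ (Gessel's fundamental quasisymmetric function). $\omega$ is the linear involution with $\omega(L_{S,n})=L_{[n-1]\setminus S,n}$. Ehrenborg's flag quasisymmetric function: for a graded poset $I$ with $\hat0,\hat1$, $F_I(\mathbf x)=\sum x_1^{\rho(t_0,t_1)}x_2^{\rho(t_1,t_2)}\cdots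 x_k^{\rho(t_{k-1},t_k)}$ over all $k\ge1$ and multichains $\hat0=t_0\le t_1\le\cdots\le t_{k-1}<t_k=\hat1$, where $\rho(s,t)=\rho(t)-\rho(s)$. For a graded poset $P$ with $\hat0$, $F_P(\mathbf x)=\sum_m F_{[\hat0,m]}(\mathbf x)$ over maximal elements $m$. *)

theory Defs
  imports Main
begin

definition covers :: "'a set \<Rightarrow> ('a \<Rightarrow> 'a \<Rightarrow> bool) \<Rightarrow> 'a \<Rightarrow> 'a \<Rightarrow> bool" where
  "covers A le x y \<equiv> x \<in> A \<and> y \<in> A \<and> le x y \<and> x \<noteq> y \<and>
     \<not> (\<exists>w\<in>A. le x w \<and> w \<noteq> x \<and> le w y \<and> w \<noteq> y)"

definition satchains :: "'a set \<Rightarrow> ('a \<Rightarrow> 'a \<Rightarrow> bool) \<Rightarrow> 'a \<Rightarrow> 'a list set" where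
  "satchains A le z = {c. c \<noteq> [] \<and> hd c = z \<and> set c \<subseteq> A \<and>
     (\<forall>i. Suc i < length c \<longrightarrow> covers A le (c!i) (c!Suc i))}"

definition is_maximal :: "'a set \<Rightarrow> ('a \<Rightarrow> 'a \<Rightarrow> bool) \<Rightarrow> 'a \<Rightarrow> bool" where
  "is_maximal A le x \<equiv> x \<in> A \<and> \<not> (\<exists>y\<in>A. le x y \<and> x \<noteq> y)"

definition maxchains :: "'a set \<Rightarrow> ('a \<Rightarrow> 'a \<Rightarrow> bool) \<Rightarrow> 'a \<Rightarrow> 'a list set" where
  "maxchains A le z = {c \<in> satchains A le z. is_maximal A le (last c)}"

definition graded_poset :: "'a set \<Rightarrow> ('a \<Rightarrow> 'a \<Rightarrow> bool) \<Rightarrow> 'a \<Rightarrow> nat \<Rightarrow> bool" where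
  "graded_poset A le z n \<equiv> finite A \<and>
     (\<forall>x\<in>A. le x x) \<and>
     (\<forall>x\<in>A. \<forall>y\<in>A. le x y \<and> le y x \<longrightarrow> x = y) \<and>
     (\<forall>x\<in>A. \<forall>y\<in>A. \<forall>w\<in>A. le x y \<and> le y w \<longrightarrow> le x w) \<and>
     z \<in> A \<and> (\<forall>x\<in>A. le z x) \<and>
     (\<forall>c\<in>maxchains A le z. length c = Suc n)"

definition prank :: "'a set \<Rightarrow> ('a \<Rightarrow> 'a \<Rightarrow> bool) \<Rightarrow> 'a \<Rightarrow> 'a \<Rightarrow> nat" where
  "prank A le z x = length (SOME c. c \<in> satchains A le z \<and> last c = x) - 1"

text \<open>lam m j is the label of the cover m!j covered-by m!(j+1) of the maximal chain m.\<close>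
definition C_labeling :: "'a set \<Rightarrow> ('a \<Rightarrow> 'a \<Rightarrow> bool) \<Rightarrow> 'a \<Rightarrow> ('a list \<Rightarrow> nat \<Rightarrow> 'l::order) \<Rightarrow> bool" where
  "C_labeling A le z lam \<equiv> \<forall>m\<in>maxchains A le z. \<forall>m'\<in>maxchains A le z. \<forall>d.
     take (Suc d) m = take (Suc d) m' \<longrightarrow> (\<forall>j<d. lam m j = lam m' j)"

definition slab :: "'a set \<Rightarrow> ('a \<Rightarrow> 'a \<Rightarrow> bool) \<Rightarrow> 'a \<Rightarrow> ('a list \<Rightarrow> nat \<Rightarrow> 'l::order) \<Rightarrow> 'a list \<Rightarrow> nat \<Rightarrow> 'l" where
  "slab A le z lam c j = lam (SOME m. m \<in> maxchains A le z \<and> take (length c) m = c) j"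

text \<open>A rooted interval [last r, last s]_r with maximal chain given by the extension s of r:
  the chain is increasing if its labels (positions length r - 1 .. length s - 2) strictly increase.\<close>
definition increasing_from :: "'a set \<Rightarrow> ('a \<Rightarrow> 'a \<Rightarrow> bool) \<Rightarrow> 'a \<Rightarrow> ('a list \<Rightarrow> nat \<Rightarrow> 'l::order) \<Rightarrow> 'a list \<Rightarrow> 'a list \<Rightarrow> bool" where
  "increasing_from A le z lam r s \<equiv> \<forall>j. length r - 1 \<le> j \<and> Suc (Suc j) < length s \<longrightarrow>
     slab A le z lam s j < slab A le z lam s (Suc j)"

definition CR_labeling :: "'a set \<Rightarrow> ('a \<Rightarrow> 'a \<Rightarrow> bool) \<Rightarrow> 'a \<Rightarrow> ('a list \<Rightarrow> nat \<Rightarrow> 'l::order) \<Rightarrow> bool" where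
  "CR_labeling A le z lam \<equiv> C_labeling A le z lam \<and>
     (\<forall>r\<in>satchains A le z. \<forall>y\<in>A. le (last r) y \<longrightarrow>
        (\<exists>!s. s \<in> satchains A le z \<and> take (length r) s = r \<and> last s = y \<and> increasing_from A le z lam r s))"

definition ascent :: "('a list \<Rightarrow> nat \<Rightarrow> 'l::order) \<Rightarrow> 'a list \<Rightarrow> nat \<Rightarrow> bool" where
  "ascent lam m i \<equiv> 1 \<le> i \<and> Suc i < length m \<and> lam m (i - 1) < lam m i"

definition swap_ok :: "'a set \<Rightarrow> ('a \<Rightarrow> 'a \<Rightarrow> bool) \<Rightarrow> 'a \<Rightarrow> ('a list \<Rightarrow> nat \<Rightarrow> 'l::order) \<Rightarrow> 'a list \<Rightarrow> nat \<Rightarrow> 'a \<Rightarrow> bool" where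
  "swap_ok A le z lam m i x \<equiv> m[i := x] \<in> maxchains A le z \<and>
     lam (m[i := x]) (i - 1) = lam m i \<and> lam (m[i := x]) i = lam m (i - 1) \<and>
     (\<forall>j. Suc j < length m \<and> j \<noteq> i - 1 \<and> j \<noteq> i \<longrightarrow> lam (m[i := x]) j = lam m j)"

definition rank_two_switching :: "'a set \<Rightarrow> ('a \<Rightarrow> 'a \<Rightarrow> bool) \<Rightarrow> 'a \<Rightarrow> ('a list \<Rightarrow> nat \<Rightarrow> 'l::order) \<Rightarrow> bool" where
  "rank_two_switching A le z lam \<equiv>
     (\<forall>m\<in>maxchains A le z. \<forall>i. ascent lam m i \<longrightarrow> (\<exists>!x. x \<noteq> m!i \<and> swap_ok A le z lam m i x)) \<and>
     (\<forall>m\<in>maxchains A le z. \<forall>m'\<in>maxchains A le z. \<forall>i x x'.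
        ascent lam m i \<and> take (Suc (Suc i)) m = take (Suc (Suc i)) m' \<and>
        x \<noteq> m!i \<and> swap_ok A le z lam m i x \<and> x' \<noteq> m'!i \<and> swap_ok A le z lam m' i x'
        \<longrightarrow> x = x')"

definition Umax :: "'a set \<Rightarrow> ('a \<Rightarrow> 'a \<Rightarrow> bool) \<Rightarrow> 'a \<Rightarrow> ('a list \<Rightarrow> nat \<Rightarrow> 'l::order) \<Rightarrow> nat \<Rightarrow> 'a list \<Rightarrow> 'a list" where
  "Umax A le z lam i m = (if ascent lam m i
     then m[i := (THE x. x \<noteq> m!i \<and> swap_ok A le z lam m i x)] else m)"

definition Usat :: "'a set \<Rightarrow> ('a \<Rightarrow> 'a \<Rightarrow> bool) \<Rightarrow> 'a \<Rightarrow> ('a list \<Rightarrow> nat \<Rightarrow> 'l::order) \<Rightarrow> nat \<Rightarrow> 'a list \<Rightarrow> 'a list" where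
  "Usat A le z lam i c = (if 1 \<le> i \<and> Suc i < length c
     then take (length c) (Umax A le z lam i (SOME m. m \<in> maxchains A le z \<and> take (length c) m = c))
     else c)"

definition rstep :: "'a set \<Rightarrow> ('a \<Rightarrow> 'a \<Rightarrow> bool) \<Rightarrow> 'a \<Rightarrow> ('a list \<Rightarrow> nat \<Rightarrow> 'l::order) \<Rightarrow> 'a list \<Rightarrow> ('a list \<times> 'a list) set" where
  "rstep A le z lam r = {(s, Usat A le z lam i s) | s i. s \<in> satchains A le z \<and>
     take (length r) s = r \<and> length r \<le> i \<and> Suc i < length s}"

definition requiv :: "'a set \<Rightarrow> ('a \<Rightarrow> 'a \<Rightarrow> bool) \<Rightarrow> 'a \<Rightarrow> ('a list \<Rightarrow> nat \<Rightarrow> 'l::order) \<Rightarrow> 'a list \<Rightarrow> 'a list \<Rightarrow> 'a list \<Rightarrow> bool" where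
  "requiv A le z lam r s s' \<equiv> s \<in> satchains A le z \<and> s' \<in> satchains A le z \<and>
     take (length r) s = r \<and> take (length r) s' = r \<and> last s = last s' \<and>
     (s, s') \<in> (rstep A le z lam r \<union> (rstep A le z lam r)\<inverse>)\<^sup>*"

definition braid_property :: "'a set \<Rightarrow> ('a \<Rightarrow> 'a \<Rightarrow> bool) \<Rightarrow> 'a \<Rightarrow> ('a list \<Rightarrow> nat \<Rightarrow> 'l::order) \<Rightarrow> bool" where
  "braid_property A le z lam \<equiv> \<forall>c\<in>satchains A le z. \<forall>i.
     1 \<le> i \<and> Suc (Suc i) < length c \<and>
     slab A le z lam c (i - 1) < slab A le z lam c i \<and> slab A le z lam c i < slab A le z lam c (Suc i)
     \<longrightarrow> Usat A le z lam i (Usat A le z lam (Suc i) (Usat A le z lam i c)) =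
         Usat A le z lam (Suc i) (Usat A le z lam i (Usat A le z lam (Suc i) c))"

text \<open>Cancellative property: r from the bottom to z', rc = r extended by a maximal chain of [z',x],
  s1, s2 = rc extended by maximal chains of [x,y].\<close>
definition cancellative :: "'a set \<Rightarrow> ('a \<Rightarrow> 'a \<Rightarrow> bool) \<Rightarrow> 'a \<Rightarrow> ('a list \<Rightarrow> nat \<Rightarrow> 'l::order) \<Rightarrow> bool" where
  "cancellative A le z lam \<equiv> \<forall>r rc s1 s2.
     r \<in> satchains A le z \<and> rc \<in> satchains A le z \<and> take (length r) rc = r \<and> length r < length rc \<and>
     s1 \<in> satchains A le z \<and> s2 \<in> satchains A le z \<and>
     take (length rc) s1 = rc \<and> take (length rc) s2 = rc \<and> length rc < length s1 \<and> last s1 = last s2 \<and>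
     requiv A le z lam r s1 s2 \<longrightarrow> requiv A le z lam rc s1 s2"

definition gen_CW_labeling :: "'a set \<Rightarrow> ('a \<Rightarrow> 'a \<Rightarrow> bool) \<Rightarrow> 'a \<Rightarrow> ('a list \<Rightarrow> nat \<Rightarrow> 'l::order) \<Rightarrow> bool" where
  "gen_CW_labeling A le z lam \<equiv> CR_labeling A le z lam \<and> rank_two_switching A le z lam \<and>
     braid_property A le z lam \<and> cancellative A le z lam"

definition qclass :: "'a set \<Rightarrow> ('a \<Rightarrow> 'a \<Rightarrow> bool) \<Rightarrow> 'a \<Rightarrow> ('a list \<Rightarrow> nat \<Rightarrow> 'l::order) \<Rightarrow> 'a list \<Rightarrow> 'a list set" where
  "qclass A le z lam s = {s'. requiv A le z lam [z] s s'}"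

definition Q_carrier :: "'a set \<Rightarrow> ('a \<Rightarrow> 'a \<Rightarrow> bool) \<Rightarrow> 'a \<Rightarrow> ('a list \<Rightarrow> nat \<Rightarrow> 'l::order) \<Rightarrow> 'a list set set" where
  "Q_carrier A le z lam = qclass A le z lam ` satchains A le z"

definition Q_le :: "'a set \<Rightarrow> ('a \<Rightarrow> 'a \<Rightarrow> bool) \<Rightarrow> 'a \<Rightarrow> ('a list \<Rightarrow> nat \<Rightarrow> 'l::order) \<Rightarrow> 'a list set \<Rightarrow> 'a list set \<Rightarrow> bool" where
  "Q_le A le z lam X Y \<longleftrightarrow> (X, Y) \<in> {(X, Y). X \<in> Q_carrier A le z lam \<and> Y \<in> Q_carrier A le z lam \<and>
      (\<exists>c\<in>X. \<exists>d\<in>Y. set c \<subseteq> set d)}\<^sup>+"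

definition Q_bot :: "'a set \<Rightarrow> ('a \<Rightarrow> 'a \<Rightarrow> bool) \<Rightarrow> 'a \<Rightarrow> ('a list \<Rightarrow> nat \<Rightarrow> 'l::order) \<Rightarrow> 'a list set" where
  "Q_bot A le z lam = qclass A le z lam [z]"

definition qtop :: "'a list set \<Rightarrow> 'a" where
  "qtop X = last (SOME c. c \<in> X)"

definition phi :: "'a list set list \<Rightarrow> 'a list" where
  "phi M = map qtop M"

definition Uword :: "'a set \<Rightarrow> ('a \<Rightarrow> 'a \<Rightarrow> bool) \<Rightarrow> 'a \<Rightarrow> ('a list \<Rightarrow> nat \<Rightarrow> 'l::order) \<Rightarrow> nat list \<Rightarrow> 'a list \<Rightarrow> 'a list" where
  "Uword A le z lam ws m = foldr (Umax A le z lam) ws m"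

text \<open>Characters, as functions on words in the generators (the monomials span H_n(0)).
  The trace of a map permuting-or-collapsing basis vectors is its number of fixed basis vectors.\<close>
definition charP :: "'a set \<Rightarrow> ('a \<Rightarrow> 'a \<Rightarrow> bool) \<Rightarrow> 'a \<Rightarrow> ('a list \<Rightarrow> nat \<Rightarrow> 'l::order) \<Rightarrow> nat list \<Rightarrow> int" where
  "charP A le z lam ws = int (card {m \<in> maxchains A le z. Uword A le z lam ws m = m})"

definition charQ :: "'a set \<Rightarrow> ('a \<Rightarrow> 'a \<Rightarrow> bool) \<Rightarrow> 'a \<Rightarrow> ('a list \<Rightarrow> nat \<Rightarrow> 'l::order) \<Rightarrow> nat list \<Rightarrow> int" where
  "charQ A le z lam ws = (let MQ = maxchains (Q_carrier A le z lam) (Q_le A le z lam) (Q_bot A le z lam) in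
     int (card {M \<in> MQ. inv_into MQ phi (Uword A le z lam ws (phi M)) = M}))"

text \<open>Irreducible characters chi_S of H_n(0).\<close>
definition hchar :: "nat set \<Rightarrow> nat list \<Rightarrow> int" where
  "hchar S ws = (if set ws \<subseteq> S then 1 else 0)"

section \<open>Quasisymmetric functions (coefficient of the monomial prod_v x_v^(alpha v))\<close>

text \<open>Gessel's fundamental quasisymmetric function L_{S,n}; variables x_1, x_2, ...\<close>
definition Lfun :: "nat set \<Rightarrow> nat \<Rightarrow> (nat \<Rightarrow> nat) \<Rightarrow> int" where
  "Lfun S n \<alpha> = int (card {is. length is = n \<and> (\<forall>v\<in>set is. 1 \<le> v) \<and> sorted is \<and>
     (\<forall>j\<in>S. 1 \<le> j \<and> j < n \<longrightarrow> is!(j - 1) < is!j) \<and> (\<forall>v. count_list is v = \<alpha> v)})"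

definition hecke_coeffs :: "nat \<Rightarrow> (nat list \<Rightarrow> int) \<Rightarrow> nat set \<Rightarrow> int" where
  "hecke_coeffs n \<chi> = (THE c. (\<forall>S. \<not> S \<subseteq> {1..<n} \<longrightarrow> c S = 0) \<and>
     (\<forall>ws. set ws \<subseteq> {1..<n} \<longrightarrow> \<chi> ws = (\<Sum>S\<in>Pow {1..<n}. c S * hchar S ws)))"

definition qch :: "nat \<Rightarrow> (nat list \<Rightarrow> int) \<Rightarrow> (nat \<Rightarrow> nat) \<Rightarrow> int" where
  "qch n \<chi> = (\<lambda>\<alpha>. \<Sum>S\<in>Pow {1..<n}. hecke_coeffs n \<chi> S * Lfun S n \<alpha>)"

definition qsym_coeffs :: "nat \<Rightarrow> ((nat \<Rightarrow> nat) \<Rightarrow> int) \<Rightarrow> nat set \<Rightarrow> int" where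
  "qsym_coeffs n f = (THE d. (\<forall>S. \<not> S \<subseteq> {1..<n} \<longrightarrow> d S = 0) \<and>
     f = (\<lambda>\<alpha>. \<Sum>S\<in>Pow {1..<n}. d S * Lfun S n \<alpha>))"

definition omega :: "nat \<Rightarrow> ((nat \<Rightarrow> nat) \<Rightarrow> int) \<Rightarrow> (nat \<Rightarrow> nat) \<Rightarrow> int" where
  "omega n f = (\<lambda>\<alpha>. \<Sum>S\<in>Pow {1..<n}. qsym_coeffs n f S * Lfun ({1..<n} - S) n \<alpha>)"

text \<open>Ehrenborg's flag quasisymmetric function of the interval [x,y]: multichains
  x = t_0 <= ... <= t_(k-1) < t_k = y, k >= 1, contributing prod_(v=1..k) x_v^(rho(t_(v-1),t_v)).\<close>
definition Fint :: "'a set \<Rightarrow> ('a \<Rightarrow> 'a \<Rightarrow> bool) \<Rightarrow> 'a \<Rightarrow> 'a \<Rightarrow> 'a \<Rightarrow> (nat \<Rightarrow> nat) \<Rightarrow> int" where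
  "Fint A le z x y \<alpha> = int (card {t. 2 \<le> length t \<and> hd t = x \<and> last t = y \<and> set t \<subseteq> A \<and>
     (\<forall>j. Suc j < length t \<longrightarrow> le (t!j) (t!Suc j)) \<and> t!(length t - 2) \<noteq> last t \<and>
     (\<forall>v. \<alpha> v = (if 1 \<le> v \<and> v < length t then prank A le z (t!v) - prank A le z (t!(v - 1)) else 0))})"

definition Fflag :: "'a set \<Rightarrow> ('a \<Rightarrow> 'a \<Rightarrow> bool) \<Rightarrow> 'a \<Rightarrow> (nat \<Rightarrow> nat) \<Rightarrow> int" where
  "Fflag A le z = (\<lambda>\<alpha>. \<Sum>m\<in>{m. is_maximal A le m}. Fint A le z z m \<alpha>)"

end

theory Submission
  imports Defs
begin

text \<open>An exchange turns an adjacent ascent of the label word into a descent, so it lowers the number of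
pairs of positions i < j whose labels increase. Hence a word in the generators fixes a maximal chain
exactly when none of its letters is an ascent of the chain, and the characteristic of the
representation is the sum, over the maximal chains m, of the fundamental function indexed by the
non-ascents of m. The flag function of P is the same sum, because a flag has a unique completion to a
maximal chain which is increasing in each gap of the flag.

In the quotient poset the roles of ascents and non-ascents are exchanged. By the cancellative property
the maximal chains of an interval correspond to one exchange class of a rooted interval of P. On such a
class the exchanges form a terminating rewriting system; it is locally confluent by the braid relation
and by the commutation of distant exchanges, so by Newman's lemma the class has exactly one ascent-free
chain. Thus the flag function of the quotient is the sum of the fundamental functions indexed by the
ascent sets, and \<omega> complements the index sets.\<close>

text \<open>Everything is phrased with saturated chains that start at \<open>z\<close>. A maximal
  chain of an interval rooted at \<open>r\<close> is a list extending \<open>r\<close>, and an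
  exchange inside that interval is one at a position \<open>i \<ge> length r\<close>. Labels and
  exchanges are primitive only on maximal chains; shorter chains borrow them from a chosen
  completion, so independence of this choice has to precede the rewriting.

  Both flag functions come from one counting lemma about a property \<open>D\<close> of inner
  positions that singles out one chain in each rooted interval. For the poset, \<open>D\<close> is
  "ascent" and the CR property supplies the chain; for the quotient, \<open>D\<close> is "no ascent"
  and the unique normal form supplies it.

  Equality in the quotient allows exchanges at all ranks, whereas the normal form above a root
  \<open>r\<close> is unique only for exchanges above \<open>r\<close>. Cancellation reconciles the
  two. Commutation of distant exchanges is not among the axioms and is extracted from the uniqueness
  in the rank two switching property.

  The characteristic and \<omega> are defined through coefficients of an expansion, so both rest on
  the uniqueness of such expansions, which is a unitriangularity argument.\<close>

section \<open>Characters and quasisymmetric functions\<close>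

text \<open>Besides \<open>c T\<close>, equation \<open>T\<close> involves only coefficients
  \<open>c S\<close> with \<open>\<mu> S < \<mu> T\<close>, so the coefficients are determined one
  after the other along \<mu>. Both coefficient functions defined by \<open>THE\<close> are
  identified in this way.\<close>

lemma unitriangular_unique:
  fixes c d :: "'i \<Rightarrow> int" and K :: "'i \<Rightarrow> 'i \<Rightarrow> int" and \<mu> :: "'i \<Rightarrow> nat"
  assumes fin: "finite I"
    and diag: "\<And>T. T \<in> I \<Longrightarrow> K T T = 1"
    and tri: "\<And>S T. S \<in> I \<Longrightarrow> T \<in> I \<Longrightarrow> K S T \<noteq> 0 \<Longrightarrow> S = T \<or> \<mu> S < \<mu> T"
    and eq: "\<And>T. T \<in> I \<Longrightarrow> (\<Sum>S\<in>I. c S * K S T) = (\<Sum>S\<in>I. d S * K S T)"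
    and "T \<in> I"
  shows "c T = d T"
  using \<open>T \<in> I\<close>
proof (induction "\<mu> T" arbitrary: T rule: less_induct)
  case less
  have "(\<Sum>S\<in>I - {T}. c S * K S T) = (\<Sum>S\<in>I - {T}. d S * K S T)"
  proof (rule sum.cong)
    fix S assume "S \<in> I - {T}"
    then show "c S * K S T = d S * K S T"
      using less tri[of S T] by (cases "K S T = 0") auto
  qed simp
  moreover have "(\<Sum>S\<in>I. c S * K S T) = c T + (\<Sum>S\<in>I - {T}. c S * K S T)"
    "(\<Sum>S\<in>I. d S * K S T) = d T + (\<Sum>S\<in>I - {T}. d S * K S T)"
    using less.prems fin by (simp_all add: sum.remove diag)
  ultimately show ?case
    using eq[OF less.prems] by simp
qed

lemma sum_fibres:
  fixes g :: "'b \<Rightarrow> int"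
  assumes "finite M" "finite I" "\<And>m. m \<in> M \<Longrightarrow> f m \<in> I"
  shows "(\<Sum>m\<in>M. g (f m)) = (\<Sum>S\<in>I. int (card {m \<in> M. f m = S}) * g S)"
proof -
  have "(\<Sum>m\<in>M. g (f m)) = (\<Sum>S\<in>I. \<Sum>m\<in>{m \<in> M. f m = S}. g (f m))"
    using assms by (intro sum.group[symmetric]) auto
  also have "\<dots> = (\<Sum>S\<in>I. int (card {m \<in> M. f m = S}) * g S)"
    by (intro sum.cong) auto
  finally show ?thesis .
qed

text \<open>One test word for each subset \<open>T\<close> suffices, the sorted list of its
  elements: \<open>hchar S\<close> is 1 on it exactly if \<open>T \<subseteq> S\<close>. Proper
  supersets have smaller complements, so the evaluation matrix is unitriangular with respect to the
  size of the complement.\<close>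

lemma hecke_coeffs_eqI:
  assumes supp: "\<And>S. \<not> S \<subseteq> {1..<n} \<Longrightarrow> c S = 0"
    and \<chi>: "\<And>ws. set ws \<subseteq> {1..<n} \<Longrightarrow> \<chi> ws = (\<Sum>S\<in>Pow {1..<n}. c S * hchar S ws)"
  shows "hecke_coeffs n \<chi> = c"
  unfolding hecke_coeffs_def
proof (rule the_equality)
  show "(\<forall>S. \<not> S \<subseteq> {1..<n} \<longrightarrow> c S = 0) \<and>
     (\<forall>ws. set ws \<subseteq> {1..<n} \<longrightarrow> \<chi> ws = (\<Sum>S\<in>Pow {1..<n}. c S * hchar S ws))"
    using assms by blast
next
  fix d assume d: "(\<forall>S. \<not> S \<subseteq> {1..<n} \<longrightarrow> d S = 0) \<and>
     (\<forall>ws. set ws \<subseteq> {1..<n} \<longrightarrow> \<chi> ws = (\<Sum>S\<in>Pow {1..<n}. d S * hchar S ws))"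
  have set_word: "set (sorted_list_of_set T) = T" if "T \<in> Pow {1..<n}" for T
    using that finite_subset[of T "{1..<n}"] by auto
  have "d T = c T" if "T \<in> Pow {1..<n}" for T
  proof (rule unitriangular_unique[where \<mu> = "\<lambda>S. card ({1..<n} - S)" and I = "Pow {1..<n}"
        and K = "\<lambda>S T. hchar S (sorted_list_of_set T)"])
    fix S T :: "nat set"
    assume ST: "S \<in> Pow {1..<n}" "T \<in> Pow {1..<n}" "hchar S (sorted_list_of_set T) \<noteq> 0"
    then have "T \<subseteq> S" using set_word[OF ST(2)] by (auto simp: hchar_def split: if_splits)
    then show "S = T \<or> card ({1..<n} - S) < card ({1..<n} - T)"
      using ST by (cases "S = T") (auto intro!: psubset_card_mono)
  next
    fix T :: "nat set" assume "T \<in> Pow {1..<n}"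
    then show "(\<Sum>S\<in>Pow {1..<n}. d S * hchar S (sorted_list_of_set T)) =
        (\<Sum>S\<in>Pow {1..<n}. c S * hchar S (sorted_list_of_set T))"
      using d \<chi>[of "sorted_list_of_set T"] set_word[of T] by simp
  qed (use that set_word in \<open>auto simp: hchar_def\<close>)
  then show "d = c"
    using supp d by (metis PowI ext)
qed

text \<open>The words counted by \<open>Lfun\<close> with the condition on \<open>S\<close> removed.
  The content \<alpha> determines such a word, so every coefficient of a fundamental function is 0
  or 1.\<close>

definition qsym_word :: "nat \<Rightarrow> (nat \<Rightarrow> nat) \<Rightarrow> nat list \<Rightarrow> bool" where
  "qsym_word n \<alpha> w \<longleftrightarrow> length w = n \<and> (\<forall>v\<in>set w. 1 \<le> v) \<and> sorted w \<and> (\<forall>v. count_list w v = \<alpha> v)"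

lemma length_filter_le_eq_sum_count:
  fixes v :: nat
  shows "length (filter (\<lambda>x. x \<le> v) w) = (\<Sum>u\<le>v. count_list w u)"
proof (induction w)
  case (Cons a w)
  have "(\<Sum>u\<le>v. count_list (a # w) u) = (\<Sum>u\<le>v. count_list w u + (if u = a then 1 else 0))"
    by (rule sum.cong) auto
  then show ?case using Cons by (simp add: sum.distrib)
qed simp

text \<open>In a sorted list the entries up to \<open>v\<close> form an initial segment. Applied to
  words, this locates every letter by partial sums of the content.\<close>

lemma sorted_nth_le_iff:
  fixes v :: "'b::linorder"
  assumes "sorted w" "j < length w"
  shows "w ! j \<le> v \<longleftrightarrow> j < length (filter (\<lambda>x. x \<le> v) w)"
  using assms
proof (induction w arbitrary: j)
  case (Cons a w)
  show ?case
  proof (cases j)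
    case 0
    then show ?thesis using Cons.prems by (auto simp: filter_empty_conv)
  next
    case (Suc i)
    show ?thesis
    proof (cases "a \<le> v")
      case True
      then show ?thesis using Cons Suc by simp
    next
      case False
      then have "filter (\<lambda>x. x \<le> v) w = []" using Cons.prems by (auto simp: filter_empty_conv)
      then show ?thesis using Cons Suc False by auto
    qed
  qed
qed simp

lemma qsym_word_nth_le_iff:
  assumes "qsym_word n \<alpha> w" "j < n"
  shows "w ! j \<le> v \<longleftrightarrow> j < (\<Sum>u\<le>v. \<alpha> u)"
  using assms sorted_nth_le_iff[of w j v] length_filter_le_eq_sum_count[of v w]
  unfolding qsym_word_def by simp

lemma qsym_word_unique:
  assumes "qsym_word n \<alpha> w" "qsym_word n \<alpha> w'"
  shows "w = w'"
proof (rule nth_equalityI)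
  show len: "length w = length w'" using assms by (simp add: qsym_word_def)
  fix j assume "j < length w"
  then have "j < n" using assms by (simp add: qsym_word_def)
  then show "w ! j = w' ! j"
    using qsym_word_nth_le_iff[OF assms(1)] qsym_word_nth_le_iff[OF assms(2)]
    by (metis order_antisym order_refl)
qed

lemma Lfun_eq_card:
  "Lfun S n \<alpha> = int (card {w. qsym_word n \<alpha> w \<and> (\<forall>j\<in>S. 1 \<le> j \<and> j < n \<longrightarrow> w!(j - 1) < w!j)})"
  unfolding Lfun_def qsym_word_def by (rule arg_cong[where f = "\<lambda>X. int (card X)"]) auto

lemma Lfun_word:
  assumes "qsym_word n \<alpha> w"
  shows "Lfun S n \<alpha> = (if \<forall>j\<in>S. 1 \<le> j \<and> j < n \<longrightarrow> w!(j - 1) < w!j then 1 else 0)"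
proof -
  have "{w. qsym_word n \<alpha> w \<and> (\<forall>j\<in>S. 1 \<le> j \<and> j < n \<longrightarrow> w!(j - 1) < w!j)} =
     (if \<forall>j\<in>S. 1 \<le> j \<and> j < n \<longrightarrow> w!(j - 1) < w!j then {w} else {})"
    (is "?L = ?R")
  proof (rule set_eqI)
    fix x show "x \<in> ?L \<longleftrightarrow> x \<in> ?R"
      using assms qsym_word_unique[OF assms, of x] by (cases "x = w") auto
  qed
  then show ?thesis by (simp add: Lfun_eq_card)
qed

lemma Lfun_no_word:
  assumes "\<nexists>w. qsym_word n \<alpha> w"
  shows "Lfun S n \<alpha> = 0"
  using assms by (simp add: Lfun_eq_card)

text \<open>The word jumps before position \<open>j\<close> exactly when a block of equal letters
  ends there, that is, when \<open>j\<close> is a partial sum of the content. For the content of a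
  flag these partial sums are the ranks that the flag visits.\<close>

lemma qsym_word_ascent_iff:
  assumes w: "qsym_word n \<alpha> w" and j: "1 \<le> j" "j < n"
  shows "w!(j - 1) < w!j \<longleftrightarrow> (\<exists>v. (\<Sum>u\<le>v. \<alpha> u) = j)"
proof
  assume "w!(j - 1) < w!j"
  then have "j - 1 < (\<Sum>u\<le>w!(j - 1). \<alpha> u)" "\<not> j < (\<Sum>u\<le>w!(j - 1). \<alpha> u)"
    using qsym_word_nth_le_iff[OF w, of "j - 1" "w!(j - 1)"] qsym_word_nth_le_iff[OF w, of j "w!(j - 1)"] j
    by simp_all
  then show "\<exists>v. (\<Sum>u\<le>v. \<alpha> u) = j" using j by (intro exI[of _ "w!(j - 1)"]) linarith
next
  assume "\<exists>v. (\<Sum>u\<le>v. \<alpha> u) = j"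
  then obtain v where "(\<Sum>u\<le>v. \<alpha> u) = j" by blast
  then have "w!(j - 1) \<le> v" "\<not> w!j \<le> v"
    using qsym_word_nth_le_iff[OF w, of "j - 1" v] qsym_word_nth_le_iff[OF w, of j v] j by auto
  then show "w!(j - 1) < w!j" by simp
qed

lemma ex_qsym_word_ascents:
  assumes "T \<subseteq> {1..<n}"
  shows "\<exists>\<alpha> w. qsym_word n \<alpha> w \<and> (\<forall>j. 1 \<le> j \<and> j < n \<longrightarrow> (w!(j - 1) < w!j \<longleftrightarrow> j \<in> T))"
proof -
  \<comment> \<open>The letter at \<open>j\<close> is the number of elements of \<open>T\<close> up
    to \<open>j\<close>, which grows exactly at the elements of \<open>T\<close>; the
    \<open>Suc\<close> keeps the letters positive, since the variables start at index 1.\<close>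
  define g where "g j = Suc (card (T \<inter> {..j}))" for j
  define w where "w = map g [0..<n]"
  have g_mono: "g i \<le> g j" if "i \<le> j" for i j
    using that by (auto simp: g_def intro!: card_mono)
  have "g (j - 1) < g j \<longleftrightarrow> j \<in> T" if "1 \<le> j" for j
  proof -
    have "{..j} = insert j {..j - 1}" using that by auto
    then show ?thesis using that by (auto simp: g_def Int_insert_right)
  qed
  moreover have "sorted w" using g_mono by (simp add: w_def sorted_iff_nth_mono)
  ultimately have "qsym_word n (count_list w) w"
    "\<forall>j. 1 \<le> j \<and> j < n \<longrightarrow> (w!(j - 1) < w!j \<longleftrightarrow> j \<in> T)"
    by (auto simp: qsym_word_def w_def g_def)
  then show ?thesis by blast
qed

text \<open>The test monomials are the contents of words whose ascent set is a prescribed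
  \<open>T\<close>. There the coefficient of the function with index \<open>S\<close> is 1 exactly
  if \<open>S \<subseteq> T\<close>, which is unitriangular with respect to cardinality.\<close>

lemma qsym_coeffs_eqI:
  assumes supp: "\<And>S. \<not> S \<subseteq> {1..<n} \<Longrightarrow> c S = 0"
    and f: "f = (\<lambda>\<alpha>. \<Sum>S\<in>Pow {1..<n}. c S * Lfun S n \<alpha>)"
  shows "qsym_coeffs n f = c"
  unfolding qsym_coeffs_def
proof (rule the_equality)
  show "(\<forall>S. \<not> S \<subseteq> {1..<n} \<longrightarrow> c S = 0) \<and> f = (\<lambda>\<alpha>. \<Sum>S\<in>Pow {1..<n}. c S * Lfun S n \<alpha>)"
    using assms by blast
next
  fix d assume d: "(\<forall>S. \<not> S \<subseteq> {1..<n} \<longrightarrow> d S = 0) \<and>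
     f = (\<lambda>\<alpha>. \<Sum>S\<in>Pow {1..<n}. d S * Lfun S n \<alpha>)"
  have "\<forall>T\<in>Pow {1..<n}. \<exists>\<alpha> w. qsym_word n \<alpha> w \<and>
      (\<forall>j. 1 \<le> j \<and> j < n \<longrightarrow> (w!(j - 1) < w!j \<longleftrightarrow> j \<in> T))"
    using ex_qsym_word_ascents by blast
  then obtain \<alpha> w where \<alpha>: "\<And>T. T \<in> Pow {1..<n} \<Longrightarrow> qsym_word n (\<alpha> T) (w T)"
    and w: "\<And>T j. T \<in> Pow {1..<n} \<Longrightarrow> 1 \<le> j \<Longrightarrow> j < n \<Longrightarrow> w T!(j - 1) < w T!j \<longleftrightarrow> j \<in> T"
    by metis
  have K: "Lfun S n (\<alpha> T) = (if S \<subseteq> T then 1 else 0)"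
    if "S \<in> Pow {1..<n}" "T \<in> Pow {1..<n}" for S T
  proof -
    have "(\<forall>j\<in>S. 1 \<le> j \<and> j < n \<longrightarrow> w T!(j - 1) < w T!j) \<longleftrightarrow> S \<subseteq> T"
      using that w[OF that(2)] by auto
    then show ?thesis using Lfun_word[OF \<alpha>[OF that(2)], of S] by simp
  qed
  have "d T = c T" if "T \<in> Pow {1..<n}" for T
  proof (rule unitriangular_unique[where \<mu> = card and I = "Pow {1..<n}"
        and K = "\<lambda>S T. Lfun S n (\<alpha> T)"])
    fix S T :: "nat set"
    assume ST: "S \<in> Pow {1..<n}" "T \<in> Pow {1..<n}" "Lfun S n (\<alpha> T) \<noteq> 0"
    then have "S \<subseteq> T" "finite T" using K finite_subset by (auto split: if_splits)
    then show "S = T \<or> card S < card T"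
      by (cases "S = T") (auto intro!: psubset_card_mono)
  next
    fix T :: "nat set" assume "T \<in> Pow {1..<n}"
    show "(\<Sum>S\<in>Pow {1..<n}. d S * Lfun S n (\<alpha> T)) = (\<Sum>S\<in>Pow {1..<n}. c S * Lfun S n (\<alpha> T))"
      using d f by metis
  qed (use that K in auto)
  then show "d = c"
    using supp d by (metis PowI ext)
qed

text \<open>Different chains may share an index set, so the coefficient of the fundamental function
  of \<open>S\<close> is the size of the fibre of \<open>f\<close> over \<open>S\<close>. Once the
  fibres are known to be the coefficients, complementing the index sets is termwise.\<close>

lemma omega_sum_Lfun:
  assumes "finite M" "\<And>m. m \<in> M \<Longrightarrow> f m \<subseteq> {1..<n}"
  shows "omega n (\<lambda>\<alpha>. \<Sum>m\<in>M. Lfun (f m) n \<alpha>) = (\<lambda>\<alpha>. \<Sum>m\<in>M. Lfun ({1..<n} - f m) n \<alpha>)"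
proof -
  let ?c = "\<lambda>S. int (card {m \<in> M. f m = S})"
  have "?c S = 0" if "\<not> S \<subseteq> {1..<n}" for S
  proof -
    have "{m \<in> M. f m = S} = {}" using that assms(2) by auto
    then show ?thesis by (metis card.empty of_nat_0)
  qed
  moreover have "(\<Sum>m\<in>M. Lfun (f m) n \<alpha>) = (\<Sum>S\<in>Pow {1..<n}. ?c S * Lfun S n \<alpha>)" for \<alpha>
    using assms by (intro sum_fibres) auto
  ultimately have "qsym_coeffs n (\<lambda>\<alpha>. \<Sum>m\<in>M. Lfun (f m) n \<alpha>) = ?c"
    by (intro qsym_coeffs_eqI) auto
  then show ?thesis
    using assms sum_fibres[of M "Pow {1..<n}" f "\<lambda>S. Lfun ({1..<n} - S) n _"]
    by (auto simp: omega_def fun_eq_iff)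
qed

text \<open>The fixed-point count in the hypothesis is the sum over \<open>m\<close> of
  \<open>hchar (f m) ws\<close>, so \<chi> is a sum of irreducible characters, one for each basis
  element.\<close>

lemma qch_card_fixed:
  assumes "finite M" "\<And>m. m \<in> M \<Longrightarrow> f m \<subseteq> {1..<n}"
    and "\<And>ws. set ws \<subseteq> {1..<n} \<Longrightarrow> \<chi> ws = int (card {m \<in> M. set ws \<subseteq> f m})"
  shows "qch n \<chi> = (\<lambda>\<alpha>. \<Sum>m\<in>M. Lfun (f m) n \<alpha>)"
proof -
  let ?c = "\<lambda>S. int (card {m \<in> M. f m = S})"
  have "?c S = 0" if "\<not> S \<subseteq> {1..<n}" for S
  proof -
    have "{m \<in> M. f m = S} = {}" using that assms(2) by auto
    then show ?thesis by (metis card.empty of_nat_0)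
  qed
  moreover have "\<chi> ws = (\<Sum>S\<in>Pow {1..<n}. ?c S * hchar S ws)" if "set ws \<subseteq> {1..<n}" for ws
  proof -
    have "\<chi> ws = (\<Sum>m\<in>M. hchar (f m) ws)"
      using assms(1,3) that by (simp add: hchar_def sum.If_cases Int_def)
    also have "\<dots> = (\<Sum>S\<in>Pow {1..<n}. ?c S * hchar S ws)"
      using assms by (intro sum_fibres) auto
    finally show ?thesis .
  qed
  ultimately have "hecke_coeffs n \<chi> = ?c"
    by (intro hecke_coeffs_eqI) auto
  then show ?thesis
    using assms sum_fibres[of M "Pow {1..<n}" f "\<lambda>S. Lfun S n _"]
    by (auto simp: qch_def fun_eq_iff)
qed

section \<open>Newman's lemma\<close>

lemma newman:
  assumes wf: "wf (R\<inverse>)"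
    and local: "\<And>a b c. (a, b) \<in> R \<Longrightarrow> (a, c) \<in> R \<Longrightarrow> \<exists>d. (b, d) \<in> R\<^sup>* \<and> (c, d) \<in> R\<^sup>*"
    and "(a, b) \<in> R\<^sup>*" "(a, c) \<in> R\<^sup>*"
  shows "\<exists>d. (b, d) \<in> R\<^sup>* \<and> (c, d) \<in> R\<^sup>*"
  using wf assms(3,4)
proof (induction a arbitrary: b c rule: wf_induct_rule)
  case (less a)
  show ?case
  proof (cases "a = b \<or> a = c")
    case False
    then obtain b' c' where b': "(a, b') \<in> R" "(b', b) \<in> R\<^sup>*" and c': "(a, c') \<in> R" "(c', c) \<in> R\<^sup>*"
      using less.prems by (metis converse_rtranclE)
    obtain d where d: "(b', d) \<in> R\<^sup>*" "(c', d) \<in> R\<^sup>*" using local[OF b'(1) c'(1)] by blast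
    obtain e where e: "(b, e) \<in> R\<^sup>*" "(d, e) \<in> R\<^sup>*" using less.IH[of b' b d] b' d by blast
    obtain f where "(e, f) \<in> R\<^sup>*" "(c, f) \<in> R\<^sup>*"
      using less.IH[of c' e c] c' d e by (metis converseI rtrancl_trans)
    then show ?thesis using e by (meson rtrancl_trans)
  qed (use less.prems in blast)
qed

text \<open>Confluence makes any two convertible elements joinable, and an irreducible element
  reaches only itself, so convertible irreducible elements coincide. Existence takes a minimal
  element among the reducts of \<open>a\<close>; termination is the well-foundedness of the converse
  relation.\<close>

lemma unique_normal_form:
  assumes wf: "wf (R\<inverse>)"
    and local: "\<And>a b c. (a, b) \<in> R \<Longrightarrow> (a, c) \<in> R \<Longrightarrow> \<exists>d. (b, d) \<in> R\<^sup>* \<and> (c, d) \<in> R\<^sup>*"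
  shows "\<exists>!b. (a, b) \<in> (R \<union> R\<inverse>)\<^sup>* \<and> b \<notin> Domain R"
proof -
  have confl: "\<exists>d. (b, d) \<in> R\<^sup>* \<and> (c, d) \<in> R\<^sup>*" if "(a, b) \<in> R\<^sup>*" "(a, c) \<in> R\<^sup>*" for a b c
    by (rule newman[OF wf _ that]) (rule local)
  have join: "\<exists>d. (b, d) \<in> R\<^sup>* \<and> (c, d) \<in> R\<^sup>*" if "(b, c) \<in> (R \<union> R\<inverse>)\<^sup>*" for b c
    using that
  proof (induction rule: rtrancl_induct)
    case (step c c')
    then obtain d where d: "(b, d) \<in> R\<^sup>*" "(c, d) \<in> R\<^sup>*" by blast
    show ?case
    proof (cases "(c, c') \<in> R")
      case True
      then obtain e where "(d, e) \<in> R\<^sup>*" "(c', e) \<in> R\<^sup>*"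
        using confl[of c d c'] d by blast
      then show ?thesis using d by (meson rtrancl_trans)
    next
      case False
      then show ?thesis using step.hyps d by (meson UnE converseD converse_rtrancl_into_rtrancl)
    qed
  qed auto
  obtain b where "(a, b) \<in> R\<^sup>*" "b \<notin> Domain R"
  proof -
    obtain b where "b \<in> {b. (a, b) \<in> R\<^sup>*}" "\<And>y. (y, b) \<in> R\<inverse> \<Longrightarrow> y \<notin> {b. (a, b) \<in> R\<^sup>*}"
      using wfE_min[OF wf, of a "{b. (a, b) \<in> R\<^sup>*}"] by blast
    then show ?thesis using that by (metis Domain.cases converse.intros mem_Collect_eq rtrancl.rtrancl_into_rtrancl)
  qed
  moreover have "(a, b) \<in> (R \<union> R\<inverse>)\<^sup>*" if "(a, b) \<in> R\<^sup>*" for b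
    using that by (meson Un_upper1 rtrancl_mono subsetD)
  moreover have "b = c" if "(a, b) \<in> (R \<union> R\<inverse>)\<^sup>*" "(a, c) \<in> (R \<union> R\<inverse>)\<^sup>*"
    "b \<notin> Domain R" "c \<notin> Domain R" for b c
  proof -
    have "(b, a) \<in> (R \<union> R\<inverse>)\<^sup>*"
      using that(1) by (metis converse_Un converse_converse rtrancl_converseI sup_commute)
    then have "(b, c) \<in> (R \<union> R\<inverse>)\<^sup>*" using that(2) by (rule rtrancl_trans)
    then obtain d where "(b, d) \<in> R\<^sup>*" "(c, d) \<in> R\<^sup>*" using join by blast
    then show "b = c" using that(3,4) by (metis Domain.DomainI converse_rtranclE)
  qed
  ultimately show ?thesis by blast
qed

section \<open>Saturated chains in graded posets\<close>

lemma satchains_nonempty: "c \<in> satchains A le z \<Longrightarrow> c \<noteq> []"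
  and satchains_hd: "c \<in> satchains A le z \<Longrightarrow> hd c = z"
  and satchains_subset: "c \<in> satchains A le z \<Longrightarrow> set c \<subseteq> A"
  and satchains_covers: "c \<in> satchains A le z \<Longrightarrow> Suc i < length c \<Longrightarrow> covers A le (c!i) (c!Suc i)"
  by (auto simp: satchains_def)

lemma satchains_last: "c \<in> satchains A le z \<Longrightarrow> last c \<in> A"
  by (metis satchains_nonempty satchains_subset last_in_set subsetD)

lemma satchains_take_1: "c \<in> satchains A le z \<Longrightarrow> take 1 c = [z]"
  using satchains_nonempty[of c] satchains_hd[of c] by (cases c) auto

lemma satchains_singleton: "z \<in> A \<Longrightarrow> [z] \<in> satchains A le z"
  by (simp add: satchains_def)

lemma satchains_snoc_iff:
  assumes "c \<noteq> []"
  shows "c @ [y] \<in> satchains A le z \<longleftrightarrow> c \<in> satchains A le z \<and> covers A le (last c) y"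
proof -
  have "(\<forall>i. Suc i < length (c @ [y]) \<longrightarrow> covers A le ((c @ [y])!i) ((c @ [y])!Suc i)) \<longleftrightarrow>
      (\<forall>i. Suc i < length c \<longrightarrow> covers A le (c!i) (c!Suc i)) \<and> covers A le (last c) y"
    (is "(\<forall>i. ?P i) \<longleftrightarrow> ?R")
  proof -
    have "?P i \<longleftrightarrow> (Suc i < length c \<longrightarrow> covers A le (c!i) (c!Suc i)) \<and>
        (Suc i = length c \<longrightarrow> covers A le (last c) y)" for i
    proof -
      have "Suc i = length c \<Longrightarrow> last c = c!i" using assms by (metis diff_Suc_1 last_conv_nth)
      then show ?thesis by (auto simp: nth_append less_Suc_eq)
    qed
    then show ?thesis using assms by (metis Suc_pred length_greater_0_conv)
  qed
  moreover have "covers A le (last c) y \<Longrightarrow> y \<in> A" by (simp add: covers_def)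
  ultimately show ?thesis using assms by (auto simp: satchains_def)
qed

lemma satchains_take:
  assumes "c \<in> satchains A le z" "0 < k"
  shows "take k c \<in> satchains A le z"
  using assms by (auto simp: satchains_def dest: in_set_takeD)

text \<open>The condition on the tail depends on \<open>c\<close> only through its last element.
  Hence tails can be moved between chains with the same end.\<close>

lemma satchains_append_iff:
  assumes "c \<noteq> []"
  shows "c @ e \<in> satchains A le z \<longleftrightarrow> c \<in> satchains A le z \<and> last c # e \<in> satchains A le (last c)"
  using assms
proof (induction e rule: rev_induct)
  case Nil
  then show ?case using satchains_last[of c A le z] satchains_singleton by auto
next
  case (snoc y e)
  have "c @ e @ [y] \<in> satchains A le z \<longleftrightarrow> c @ e \<in> satchains A le z \<and> covers A le (last (c @ e)) y"
    using satchains_snoc_iff[of "c @ e" y A le z] snoc.prems by simp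
  moreover have "last c # e @ [y] \<in> satchains A le (last c) \<longleftrightarrow>
      last c # e \<in> satchains A le (last c) \<and> covers A le (last (last c # e)) y"
    using satchains_snoc_iff[of "last c # e" y A le "last c"] by simp
  moreover have "last (c @ e) = last (last c # e)" using snoc.prems by simp
  ultimately show ?case using snoc.IH snoc.prems by simp
qed

locale graded =
  fixes A :: "'a set" and le :: "'a \<Rightarrow> 'a \<Rightarrow> bool" and z :: 'a and n :: nat
  assumes graded: "graded_poset A le z n"
begin

abbreviation "SC \<equiv> satchains A le z"
abbreviation "MC \<equiv> maxchains A le z"

lemma finite_carrier: "finite A"
  and refl_le: "x \<in> A \<Longrightarrow> le x x"
  and antisym_le: "x \<in> A \<Longrightarrow> y \<in> A \<Longrightarrow> le x y \<Longrightarrow> le y x \<Longrightarrow> x = y"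
  and trans_le: "x \<in> A \<Longrightarrow> y \<in> A \<Longrightarrow> w \<in> A \<Longrightarrow> le x y \<Longrightarrow> le y w \<Longrightarrow> le x w"
  and bot_in: "z \<in> A"
  and bot_le: "x \<in> A \<Longrightarrow> le z x"
  and length_maxchain: "c \<in> MC \<Longrightarrow> length c = Suc n"
  using graded unfolding graded_poset_def by (metis+)

lemma satchain_lt:
  assumes "c \<in> satchains A le x" "i < j" "j < length c"
  shows "le (c!i) (c!j) \<and> c!i \<noteq> c!j"
  using assms(2,3)
proof (induction j)
  case (Suc j)
  have cov: "covers A le (c!j) (c!Suc j)" using satchains_covers[OF assms(1) Suc.prems(2)] .
  have mem: "c!i \<in> A" "c!j \<in> A" "c!Suc j \<in> A"
    using satchains_subset[OF assms(1)] Suc.prems by (auto simp: subset_iff)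
  show ?case
  proof (cases "i = j")
    case False
    then have "le (c!i) (c!j) \<and> c!i \<noteq> c!j" using Suc by simp
    then show ?thesis using cov mem trans_le antisym_le unfolding covers_def by metis
  qed (use cov in \<open>simp add: covers_def\<close>)
qed simp

lemma satchain_mono:
  assumes "c \<in> satchains A le x" "i \<le> j" "j < length c"
  shows "le (c!i) (c!j)"
  using assms satchain_lt[of c x i j] refl_le satchains_subset[OF assms(1)]
  by (cases "i = j") (auto simp: subset_iff)

lemma distinct_satchain: "c \<in> satchains A le x \<Longrightarrow> distinct c"
  unfolding distinct_conv_nth by (metis linorder_neqE_nat satchain_lt)

lemma length_satchain_le_card: "c \<in> satchains A le x \<Longrightarrow> length c \<le> card A"
  using distinct_satchain satchains_subset finite_carrier by (metis card_mono distinct_card)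

lemma ex_cover:
  assumes "x \<in> A" "y \<in> A" "le x y" "x \<noteq> y"
  shows "\<exists>w. covers A le x w \<and> le w y"
  using assms(2-4)
proof (induction "card {w \<in> A. le x w \<and> le w y}" arbitrary: y rule: less_induct)
  case less
  show ?case
  proof (cases "covers A le x y")
    case False
    then obtain w where w: "w \<in> A" "le x w" "w \<noteq> x" "le w y" "w \<noteq> y"
      using less.prems assms(1) unfolding covers_def by blast
    have "{v \<in> A. le x v \<and> le v w} \<subseteq> {v \<in> A. le x v \<and> le v y}"
      using w less.prems trans_le by blast
    moreover have "y \<notin> {v \<in> A. le x v \<and> le v w}" "y \<in> {v \<in> A. le x v \<and> le v y}"
      using w less.prems antisym_le refl_le by auto
    ultimately have "card {v \<in> A. le x v \<and> le v w} < card {v \<in> A. le x v \<and> le v y}"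
      using finite_carrier by (intro psubset_card_mono) auto
    then obtain v where "covers A le x v" "le v w" using less.hyps[of w] w by blast
    moreover have "v \<in> A" using \<open>covers A le x v\<close> by (simp add: covers_def)
    ultimately show ?thesis using w less.prems trans_le by blast
  qed (use less.prems refl_le in blast)
qed

text \<open>Saturated chains have distinct elements, so their length is bounded by
  \<open>card A\<close> and repeated extension by covers stops.\<close>

lemma satchain_extends:
  assumes "c \<in> satchains A le x"
  shows "\<exists>e. c @ e \<in> satchains A le x \<and> is_maximal A le (last (c @ e))"
  using assms
proof (induction "card A - length c" arbitrary: c rule: less_induct)
  case less
  show ?case
  proof (cases "is_maximal A le (last c)")
    case True
    then show ?thesis using less.prems by (intro exI[of _ "[]"]) simp
  next
    case False
    then obtain w where "covers A le (last c) w"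
      using satchains_last[OF less.prems] ex_cover unfolding is_maximal_def by metis
    then have cw: "c @ [w] \<in> satchains A le x"
      using less.prems satchains_nonempty satchains_snoc_iff by metis
    then have "card A - length (c @ [w]) < card A - length c"
      using length_satchain_le_card[OF cw] by simp
    then obtain e where "(c @ [w]) @ e \<in> satchains A le x" "is_maximal A le (last ((c @ [w]) @ e))"
      using less.hyps[OF _ cw] by blast
    then show ?thesis by (intro exI[of _ "w # e"]) simp
  qed
qed

lemma ex_maxchain:
  assumes "c \<in> SC"
  obtains m where "m \<in> MC" "take (length c) m = c"
  using satchain_extends[OF assms] that by (force simp: maxchains_def)

text \<open>Gradedness is assumed for maximal chains only. Appending one common tail turns both
  chains into maximal chains, whose lengths agree. This makes \<open>prank\<close> independent of
  the chosen chain.\<close>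

lemma length_satchain_eqI:
  assumes "c \<in> SC" "d \<in> SC" "last c = last d"
  shows "length c = length d"
proof -
  obtain e where e: "c @ e \<in> SC" "is_maximal A le (last (c @ e))"
    using satchain_extends assms(1) by blast
  have "d @ e \<in> SC"
    using e(1) assms satchains_append_iff[of c e A le z] satchains_append_iff[of d e A le z]
    by (simp add: satchains_nonempty)
  moreover have "last (d @ e) = last (c @ e)" using assms(3) by (simp add: last_append)
  ultimately show ?thesis
    using e length_maxchain[of "c @ e"] length_maxchain[of "d @ e"] by (simp add: maxchains_def)
qed

lemma prank_satchain: "c \<in> SC \<Longrightarrow> prank A le z (last c) = length c - 1"
proof -
  assume c: "c \<in> SC"
  let ?d = "SOME d. d \<in> SC \<and> last d = last c"
  have "?d \<in> SC \<and> last ?d = last c"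
    by (rule someI[of "\<lambda>d. d \<in> SC \<and> last d = last c" c]) (simp add: c)
  then show ?thesis using length_satchain_eqI[of ?d c] c by (simp add: prank_def)
qed

lemma satchain_extends_to:
  assumes "c \<in> satchains A le x" "y \<in> A" "le (last c) y"
  shows "\<exists>e. c @ e \<in> satchains A le x \<and> last (c @ e) = y"
  using assms(1,3)
proof (induction "card A - length c" arbitrary: c rule: less_induct)
  case less
  show ?case
  proof (cases "last c = y")
    case True
    then show ?thesis using less.prems by (intro exI[of _ "[]"]) simp
  next
    case False
    then obtain w where w: "covers A le (last c) w" "le w y"
      using satchains_last[OF less.prems(1)] ex_cover less.prems assms(2) by metis
    then have cw: "c @ [w] \<in> satchains A le x"
      using less.prems satchains_nonempty satchains_snoc_iff by metis
    then have "card A - length (c @ [w]) < card A - length c"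
      using length_satchain_le_card[OF cw] by simp
    then obtain e where "(c @ [w]) @ e \<in> satchains A le x" "last ((c @ [w]) @ e) = y"
      using less.hyps[OF _ cw] w by auto
    then show ?thesis by (intro exI[of _ "w # e"]) simp
  qed
qed

lemma ex_satchain_to:
  assumes "y \<in> A"
  obtains c where "c \<in> SC" "last c = y"
  using satchain_extends_to[OF satchains_singleton[OF bot_in], of y] assms bot_le that by auto

lemma prank_lt:
  assumes "x \<in> A" "y \<in> A" "le x y" "x \<noteq> y"
  shows "prank A le z x < prank A le z y"
proof -
  obtain c where c: "c \<in> SC" "last c = x" using ex_satchain_to assms by blast
  then obtain e where e: "c @ e \<in> SC" "last (c @ e) = y"
    using satchain_extends_to assms by blast
  then show ?thesis
    using prank_satchain[OF c(1)] prank_satchain[OF e(1)] c assms satchains_nonempty[OF c(1)]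
    by (cases e; cases c) auto
qed

lemma prank_mono: "x \<in> A \<Longrightarrow> y \<in> A \<Longrightarrow> le x y \<Longrightarrow> prank A le z x \<le> prank A le z y"
  using prank_lt by (metis less_imp_le order_refl)

lemma prank_bot: "prank A le z z = 0"
  using prank_satchain[OF satchains_singleton[OF bot_in]] by simp

lemma prank_maximal: "is_maximal A le x \<Longrightarrow> prank A le z x = n"
proof -
  assume x: "is_maximal A le x"
  then obtain c where "c \<in> SC" "last c = x" using ex_satchain_to by (auto simp: is_maximal_def)
  then show ?thesis using x prank_satchain[of c] length_maxchain[of c] by (simp add: maxchains_def)
qed

lemma prank_nth: "c \<in> SC \<Longrightarrow> i < length c \<Longrightarrow> prank A le z (c!i) = i"
  using prank_satchain[OF satchains_take[of c A le z "Suc i"]]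
  by (simp add: last_conv_nth satchains_nonempty)

lemma finite_satchains: "finite SC"
proof (rule finite_subset)
  show "SC \<subseteq> {c. set c \<subseteq> A \<and> length c \<le> card A}"
    by (simp add: subset_iff[of SC] satchains_subset length_satchain_le_card)
  show "finite {c. set c \<subseteq> A \<and> length c \<le> card A}"
    using finite_carrier by (rule finite_lists_length_le)
qed

lemma finite_maxchains: "finite MC"
  using finite_satchains by (rule rev_finite_subset) (auto simp: maxchains_def)

end

section \<open>Flags and distinguished chains\<close>

lemma count_list_replicate_eq: "count_list (replicate m x) y = (if x = y then m else 0)"
  by (induction m) auto

text \<open>The witness lists each letter \<open>v\<close> exactly \<open>\<alpha> v\<close> times,
  in increasing order. The condition at 0 empties the block of the forbidden letter 0, and
  \<open>0 < \<alpha> k\<close> makes \<open>k\<close> the last letter.\<close>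

lemma qsym_word_exI:
  assumes "\<alpha> 0 = 0" "0 < \<alpha> k" "\<And>v. k < v \<Longrightarrow> \<alpha> v = 0" "(\<Sum>u\<le>k. \<alpha> u) = n"
  shows "\<exists>w. qsym_word n \<alpha> w \<and> last w = k"
proof -
  define w where "w k = concat (map (\<lambda>v. replicate (\<alpha> v) v) [0..<Suc k])" for k
  have w_Suc: "w (Suc k) = w k @ replicate (\<alpha> (Suc k)) (Suc k)" for k by (simp add: w_def)
  have w: "sorted (w k) \<and> set (w k) \<subseteq> {..k} \<and> length (w k) = (\<Sum>u\<le>k. \<alpha> u) \<and>
      (\<forall>v. count_list (w k) v = (if v \<le> k then \<alpha> v else 0))" for k
  proof (induction k)
    case 0
    show ?case by (auto simp: w_def count_list_replicate_eq)
  next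
    case (Suc k)
    have "count_list (w k) v = (if v \<le> k then \<alpha> v else 0)" for v using Suc by blast
    then show ?case using Suc by (auto simp: w_Suc sorted_append count_list_replicate_eq)
  qed
  have "0 \<notin> set (w k)"
    using w[of k] assms(1) count_list_0_iff by (metis le0)
  moreover have "count_list (w k) v = \<alpha> v" for v
    using w[of k] assms(3)[of v] by auto
  ultimately have "qsym_word n \<alpha> (w k)"
    using w[of k] assms(4) by (auto simp: qsym_word_def Suc_le_eq intro: gr0I)
  moreover have "last (w k) = k"
    using assms(1,2) w_Suc[of "k - 1"] by (cases k) auto
  ultimately show ?thesis by blast
qed

lemma qsym_word_last:
  assumes w: "qsym_word n \<alpha> w" and n: "1 \<le> n"
  shows "1 \<le> last w" and "\<alpha> 0 = 0" and "0 < \<alpha> (last w)" and "last w < v \<Longrightarrow> \<alpha> v = 0"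
    and "(\<Sum>u\<le>last w. \<alpha> u) = n"
proof -
  have ne: "w \<noteq> []" and len: "length w = n" using w n by (auto simp: qsym_word_def)
  have \<alpha>: "\<alpha> v = count_list w v" for v using w by (simp add: qsym_word_def)
  show "1 \<le> last w" using w ne by (simp add: qsym_word_def)
  show "\<alpha> 0 = 0" using w \<alpha> by (auto simp: qsym_word_def count_list_0_iff)
  show "0 < \<alpha> (last w)" using \<alpha> ne count_list_0_iff[of w "last w"] by auto
  have le: "x \<le> last w" if x: "x \<in> set w" for x
  proof -
    obtain j where "j < length w" "x = w!j" using x by (auto simp: in_set_conv_nth)
    then show ?thesis
      using w ne sorted_nth_mono[of w j "length w - 1"] by (simp add: qsym_word_def last_conv_nth)
  qed
  show "last w < v \<Longrightarrow> \<alpha> v = 0" using le[of v] \<alpha> by (auto simp: count_list_0_iff)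
  have "filter (\<lambda>x. x \<le> last w) w = w" using le by simp
  then show "(\<Sum>u\<le>last w. \<alpha> u) = n"
    using length_filter_le_eq_sum_count[of "last w" w] len \<alpha> by simp
qed

context graded
begin

text \<open>Merges the sets counted in the summands of \<open>Fflag\<close>, so that a coefficient
  of the flag function becomes a single cardinality.\<close>

definition multichains :: "(nat \<Rightarrow> nat) \<Rightarrow> 'a list set" where
  "multichains \<alpha> = {t. 2 \<le> length t \<and> hd t = z \<and> is_maximal A le (last t) \<and> set t \<subseteq> A \<and>
     (\<forall>j. Suc j < length t \<longrightarrow> le (t!j) (t!Suc j)) \<and> t!(length t - 2) \<noteq> last t \<and>
     (\<forall>v. \<alpha> v = (if 1 \<le> v \<and> v < length t then prank A le z (t!v) - prank A le z (t!(v - 1)) else 0))}"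

text \<open>The rank differences telescope, so the ranks along the flag are partial sums of
  \<alpha>. The strictness of the last step gives a positive final exponent; thereby \<alpha> alone
  fixes the length of the flag.\<close>

lemma multichain_word:
  assumes t: "t \<in> multichains \<alpha>"
  shows "\<exists>w. qsym_word n \<alpha> w \<and> length t = Suc (last w)"
    and "v < length t \<Longrightarrow> prank A le z (t!v) = (\<Sum>u\<le>v. \<alpha> u)"
proof -
  have len: "2 \<le> length t" and max: "is_maximal A le (last t)"
    and sub: "\<And>v. v < length t \<Longrightarrow> t!v \<in> A" and neq: "t!(length t - 2) \<noteq> last t"
    and chain: "\<And>j. Suc j < length t \<Longrightarrow> le (t!j) (t!Suc j)"
    and \<alpha>: "\<And>v. \<alpha> v = (if 1 \<le> v \<and> v < length t then prank A le z (t!v) - prank A le z (t!(v - 1)) else 0)"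
    using t by (auto simp: multichains_def)
  have "hd t = z" using t by (simp add: multichains_def)
  then have t0: "t!0 = z" using len by (cases t) auto
  have \<alpha>0: "\<alpha> 0 = 0" using \<alpha>[of 0] by simp
  show psum: "prank A le z (t!v) = (\<Sum>u\<le>v. \<alpha> u)" if "v < length t" for v
    using that
  proof (induction v)
    case (Suc v)
    then show ?case
      using \<alpha>[of "Suc v"] prank_mono[OF sub sub chain, of v] by simp
  qed (simp add: t0 prank_bot \<alpha>0)
  define k where "k = length t - 1"
  have "last t = t!(length t - 1)" using len by (intro last_conv_nth) auto
  then have k: "length t = Suc k" "1 \<le> k" "t!(k - 1) \<noteq> t!k" "last t = t!k"
    using len neq by (auto simp: k_def numeral_2_eq_2)
  have "0 < \<alpha> k"
    using \<alpha>[of k] k prank_lt[OF sub sub chain, of "k - 1"] by auto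
  moreover have "(\<Sum>u\<le>k. \<alpha> u) = n"
    using psum[of k] k prank_maximal[OF max] by simp
  ultimately show "\<exists>w. qsym_word n \<alpha> w \<and> length t = Suc (last w)"
    using qsym_word_exI[of \<alpha> k n] \<alpha>0 \<alpha> k by auto
qed

text \<open>Once the word is fixed, the exponent conditions, which are truncated differences, amount
  to prescribing the rank of every member of the flag. Beyond \<open>last w\<close> all exponents
  vanish, in accordance with the default 0 in the definition.\<close>

lemma multichains_eq:
  assumes w: "qsym_word n \<alpha> w" and n: "1 \<le> n"
  shows "multichains \<alpha> = {t. length t = Suc (last w) \<and> t!0 = z \<and> is_maximal A le (t!last w) \<and> set t \<subseteq> A \<and>
     (\<forall>j<last w. le (t!j) (t!Suc j)) \<and> (\<forall>v\<le>last w. prank A le z (t!v) = (\<Sum>u\<le>v. \<alpha> u))}" (is "_ = ?T")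
proof (intro set_eqI iffI)
  fix t assume t: "t \<in> multichains \<alpha>"
  then obtain w' where "qsym_word n \<alpha> w'" "length t = Suc (last w')"
    using multichain_word(1) by blast
  then have len: "length t = Suc (last w)" using w qsym_word_unique by blast
  then have "last t = t!last w" "t!0 = hd t"
    by (metis diff_Suc_1 last_conv_nth length_0_conv nat.distinct(1))
      (metis hd_conv_nth len length_0_conv nat.distinct(1))
  then show "t \<in> ?T"
    using t len multichain_word(2)[OF t] by (auto simp: multichains_def)
next
  fix t assume t: "t \<in> ?T"
  note l = qsym_word_last[OF w n]
  have len: "length t = Suc (last w)" using t by simp
  then have last: "last t = t!last w" "hd t = t!0"
    by (metis diff_Suc_1 last_conv_nth length_0_conv nat.distinct(1))
      (metis hd_conv_nth len length_0_conv nat.distinct(1))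
  have pr: "prank A le z (t!v) = (\<Sum>u\<le>v. \<alpha> u)" if "v \<le> last w" for v using t that by simp
  have diff: "\<alpha> v = prank A le z (t!v) - prank A le z (t!(v - 1))" if "1 \<le> v" "v \<le> last w" for v
    using pr[of v] pr[of "v - 1"] that by (cases v) auto
  have "t!(last w - 1) \<noteq> t!last w"
    using diff[of "last w"] l(1,3) by (metis diff_self_eq_0 less_irrefl order_refl)
  moreover have "length t - 2 = last w - 1" using len by simp
  moreover have "\<alpha> v = (if 1 \<le> v \<and> v < length t then prank A le z (t!v) - prank A le z (t!(v - 1)) else 0)" for v
    using diff[of v] l(2) l(4)[of v] len by (cases "v = 0") auto
  ultimately show "t \<in> multichains \<alpha>"
    using t last l(1) by (simp add: multichains_def)
qed

lemma Fflag_eq_card_multichains: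
  assumes n: "1 \<le> n"
  shows "Fflag A le z \<alpha> = int (card (multichains \<alpha>))"
proof -
  let ?X = "\<lambda>m. {t \<in> multichains \<alpha>. last t = m}"
  have fin: "finite (multichains \<alpha>)"
  proof (cases "\<exists>w. qsym_word n \<alpha> w")
    case True
    then obtain w where w: "qsym_word n \<alpha> w" by blast
    show ?thesis
      by (rule finite_subset[OF _ finite_lists_length_eq[OF finite_carrier, of "Suc (last w)"]])
        (auto simp: multichains_eq[OF w n])
  next
    case False
    then have "multichains \<alpha> = {}" using multichain_word(1) by blast
    then show ?thesis by simp
  qed
  have "Fint A le z z m \<alpha> = int (card (?X m))" if "is_maximal A le m" for m
    unfolding Fint_def multichains_def using that
    by (intro arg_cong[where f = "\<lambda>X. int (card X)"]) auto
  then have "Fflag A le z \<alpha> = (\<Sum>m\<in>{m. is_maximal A le m}. int (card (?X m)))"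
    by (simp add: Fflag_def)
  also have "\<dots> = int (card (\<Union>m\<in>{m. is_maximal A le m}. ?X m))"
  proof (subst card_UN_disjoint)
    show "finite {m. is_maximal A le m}"
      by (rule finite_subset[OF _ finite_carrier]) (auto simp: is_maximal_def)
  qed (use fin in auto)
  also have "(\<Union>m\<in>{m. is_maximal A le m}. ?X m) = multichains \<alpha>"
    by (auto simp: multichains_def)
  finally show ?thesis .
qed

text \<open>A property D of the inner positions of saturated chains that picks out exactly one maximal
  chain in each rooted interval turns flags into maximal chains: complete a flag by the distinguished
  chain in each of its gaps.\<close>

lemma ex1_chain_through_multichain:
  assumes prefix: "\<And>s i k. s \<in> SC \<Longrightarrow> 1 \<le> i \<Longrightarrow> Suc i < k \<Longrightarrow> k \<le> length s \<Longrightarrow> D (take k s) i = D s i"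
    and uniq: "\<And>r y. r \<in> SC \<Longrightarrow> y \<in> A \<Longrightarrow> le (last r) y \<Longrightarrow>
      \<exists>!s. s \<in> SC \<and> take (length r) s = r \<and> last s = y \<and> (\<forall>i. length r \<le> i \<and> Suc i < length s \<longrightarrow> D s i)"
    and t: "t!0 = z" "\<And>v. v \<le> k \<Longrightarrow> t!v \<in> A" "\<And>j. j < k \<Longrightarrow> le (t!j) (t!Suc j)"
      "\<And>v. v \<le> k \<Longrightarrow> prank A le z (t!v) = b v"
    and "v \<le> k"
  shows "\<exists>!s. s \<in> SC \<and> length s = Suc (b v) \<and> (\<forall>u\<le>v. s!b u = t!u) \<and>
    (\<forall>i. 1 \<le> i \<and> i < b v \<and> i \<notin> b ` {..v} \<longrightarrow> D s i)" (is "\<exists>!s. ?Q v s")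
  using \<open>v \<le> k\<close>
proof (induction v)
  case 0
  have b0: "b 0 = 0" using t(1) t(4)[of 0] prank_bot by simp
  have "?Q 0 s \<longleftrightarrow> s = [z]" for s
  proof
    assume "?Q 0 s"
    then show "s = [z]" using satchains_take_1[of s A le z] b0 by simp
  qed (use b0 t(1) satchains_singleton bot_in in simp)
  then show ?case by simp
next
  case (Suc v)
  then have "\<exists>!s. ?Q v s" by simp
  then obtain r where r: "?Q v r" and "\<forall>s. ?Q v s \<longrightarrow> s = r" unfolding Ex1_def by blast
  then have r_uniq: "s = r" if "?Q v s" for s using that by blast
  have b_mono: "b u \<le> b v'" if "u \<le> v'" "v' \<le> k" for u v'
    using that
  proof (induction v')
    case (Suc v')
    have "b v' \<le> b (Suc v')"
      using prank_mono[of "t!v'" "t!Suc v'"] t(2-4) Suc.prems by simp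
    then show ?case using Suc by (cases "u = Suc v'") auto
  qed simp
  have r_last: "last r = t!v"
    using r by (metis diff_Suc_1 last_conv_nth order_refl satchains_nonempty)
  let ?y = "t!Suc v"
  let ?P = "\<lambda>s. s \<in> SC \<and> take (length r) s = r \<and> last s = ?y \<and>
    (\<forall>i. length r \<le> i \<and> Suc i < length s \<longrightarrow> D s i)"
  have len_r: "length r = Suc (b v)" using r by simp
  have bv: "b v \<le> b (Suc v)" using b_mono[of v "Suc v"] Suc.prems by simp
  \<comment> \<open>Truncating a solution for \<open>v + 1\<close> at rank \<open>b v\<close> gives
    a solution for \<open>v\<close>, which must be \<open>r\<close>. So the solutions for
    \<open>v + 1\<close> are the distinguished extensions of \<open>r\<close> up to
    \<open>t!Suc v\<close>; a repeated flag member gives a trivial interval.\<close>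
  have "?Q (Suc v) s \<longleftrightarrow> ?P s" for s
  proof
    assume s: "?Q (Suc v) s"
    let ?s = "take (Suc (b v)) s"
    have "?Q v ?s"
    proof (intro conjI allI impI)
      show "?s \<in> SC" using s by (simp add: satchains_take)
      show "length ?s = Suc (b v)" using s bv by simp
      fix u assume "u \<le> v"
      then show "?s!b u = t!u" using s b_mono[of u v] Suc.prems by simp
    next
      fix i assume i: "1 \<le> i \<and> i < b v \<and> i \<notin> b ` {..v}"
      then have "i \<notin> b ` {..Suc v}" using bv by (auto simp: atMost_Suc)
      then have "D s i" using s i bv by simp
      then show "D ?s i" using prefix[of s i "Suc (b v)"] s i bv by simp
    qed
    then have "?s = r" by (rule r_uniq)
    moreover have "last s = ?y"
      using s by (metis diff_Suc_1 last_conv_nth order_refl satchains_nonempty)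
    moreover have "D s i" if "length r \<le> i" "Suc i < length s" for i
    proof -
      have "b u < i" if "u \<le> v" for u
        using b_mono[of u v] that Suc.prems \<open>length r \<le> i\<close> len_r by simp
      then have "i \<notin> b ` {..Suc v}" using that(2) s by (auto simp: atMost_Suc)
      then show ?thesis using s that len_r by simp
    qed
    ultimately show "?P s" using s len_r by simp
  next
    assume s: "?P s"
    then have len: "length s = Suc (b (Suc v))"
      using prank_satchain[of s] satchains_nonempty[of s] t(4)[of "Suc v"] Suc.prems
      by (cases s) auto
    show "?Q (Suc v) s"
    proof (intro conjI allI impI)
      show "s \<in> SC" using s by simp
      show "length s = Suc (b (Suc v))" by (fact len)
      fix u assume u: "u \<le> Suc v"
      show "s!b u = t!u"
      proof (cases "u = Suc v")
        case True
        then show ?thesis using s len by (metis diff_Suc_1 last_conv_nth satchains_nonempty)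
      next
        case False
        then have "b u < length r" "u \<le> v" using b_mono[of u v] u len_r Suc.prems by auto
        then show ?thesis using s r by (metis nth_take)
      qed
    next
      fix i assume i: "1 \<le> i \<and> i < b (Suc v) \<and> i \<notin> b ` {..Suc v}"
      then have "i \<noteq> b v" "i \<notin> b ` {..v}" by auto
      then consider "i < b v" | "b v < i" by linarith
      then show "D s i"
      proof cases
        case 1
        then have "D r i" using r i \<open>i \<notin> b ` {..v}\<close> by blast
        then show ?thesis using prefix[of s i "length r"] s i 1 len len_r bv by simp
      next
        case 2
        then show ?thesis using s i len len_r by simp
      qed
    qed
  qed
  moreover have "\<exists>!s. ?P s"
    using uniq[of r ?y] r r_last t(2)[of "Suc v"] t(3)[of v] Suc.prems by simp
  ultimately show ?case by simp
qed

text \<open>Both sides count the maximal chains all of whose positions violating \<open>D\<close>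
  lie at ranks visited by the flag. On the left such a chain is the completion of its flag; on the
  right, the fundamental function indexed by the violations has coefficient 1 exactly if they are
  all partial sums of \<alpha>.\<close>

lemma Fflag_eq_sum_Lfun:
  assumes n: "1 \<le> n"
    and prefix: "\<And>s i k. s \<in> SC \<Longrightarrow> 1 \<le> i \<Longrightarrow> Suc i < k \<Longrightarrow> k \<le> length s \<Longrightarrow> D (take k s) i = D s i"
    and uniq: "\<And>r y. r \<in> SC \<Longrightarrow> y \<in> A \<Longrightarrow> le (last r) y \<Longrightarrow>
      \<exists>!s. s \<in> SC \<and> take (length r) s = r \<and> last s = y \<and> (\<forall>i. length r \<le> i \<and> Suc i < length s \<longrightarrow> D s i)"
  shows "Fflag A le z \<alpha> = (\<Sum>m\<in>MC. Lfun {i \<in> {1..<n}. \<not> D m i} n \<alpha>)"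
proof (cases "\<exists>w. qsym_word n \<alpha> w")
  case False
  then have "multichains \<alpha> = {}" using multichain_word(1) by blast
  then show ?thesis using False by (simp add: Fflag_eq_card_multichains[OF n] Lfun_no_word)
next
  case True
  then obtain w where w: "qsym_word n \<alpha> w" by blast
  define b where "b v = (\<Sum>u\<le>v. \<alpha> u)" for v
  define k where "k = last w"
  \<comment> \<open>The image of the completion map. Its inverse \<open>g\<close> reads off the
    members at the ranks \<open>b v\<close>, which repeat wherever an exponent is 0.\<close>
  define M' where "M' = {m \<in> MC. \<forall>i\<in>{1..<n}. i \<notin> b ` {..k} \<longrightarrow> D m i}"
  define g where "g m = map (\<lambda>v. m!b v) [0..<Suc k]" for m :: "'a list"
  note l = qsym_word_last[OF w n, folded k_def]
  have b_mono: "b u \<le> b v" if "u \<le> v" for u v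
    unfolding b_def using that by (intro sum_mono2) auto
  have bk: "b k = n" "b 0 = 0" using l by (simp_all add: b_def)
  have T: "multichains \<alpha> = {t. length t = Suc k \<and> t!0 = z \<and> is_maximal A le (t!k) \<and> set t \<subseteq> A \<and>
     (\<forall>j<k. le (t!j) (t!Suc j)) \<and> (\<forall>v\<le>k. prank A le z (t!v) = b v)}"
    using multichains_eq[OF w n] by (simp add: b_def k_def)
  have "bij_betw g M' (multichains \<alpha>)"
  proof (rule bij_betwI')
    fix m assume "m \<in> M'"
    then have m: "m \<in> MC" "m \<in> SC" "length m = Suc n" "is_maximal A le (m!n)" "m!0 = z"
      using length_maxchain[of m] satchains_take_1[of m A le z] satchains_nonempty[of m A le z]
      by (auto simp: M'_def maxchains_def last_conv_nth take_Suc hd_conv_nth)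
    have le: "b v < length m" if "v \<le> k" for v using b_mono[OF that] bk m by simp
    show "g m \<in> multichains \<alpha>"
      unfolding T using m le bk prank_nth[OF m(2) le] satchain_mono[OF m(2) b_mono le] satchains_subset[OF m(2)]
      by (auto simp: g_def subset_iff simp del: upt_Suc)
  next
    fix t assume t: "t \<in> multichains \<alpha>"
    then have t': "length t = Suc k" "t!0 = z" "is_maximal A le (t!k)" "\<And>v. v \<le> k \<Longrightarrow> t!v \<in> A"
      "\<And>j. j < k \<Longrightarrow> le (t!j) (t!Suc j)" "\<And>v. v \<le> k \<Longrightarrow> prank A le z (t!v) = b v"
      using T by (auto simp: subset_iff)
    obtain s where s: "s \<in> SC" "length s = Suc (b k)" "\<And>u. u \<le> k \<Longrightarrow> s!b u = t!u"
      "\<And>i. 1 \<le> i \<and> i < b k \<and> i \<notin> b ` {..k} \<Longrightarrow> D s i"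
      using ex1_chain_through_multichain[OF prefix uniq t'(2,4,5,6) order_refl] by blast
    have "last s = t!k" using s by (metis diff_Suc_1 last_conv_nth order_refl satchains_nonempty)
    then have "s \<in> M'" using s t'(3) bk by (simp add: M'_def maxchains_def)
    moreover have "t = g s"
      using t'(1) s(3) by (intro nth_equalityI) (auto simp: g_def simp del: upt_Suc)
    ultimately show "\<exists>m\<in>M'. t = g m" by blast
  next
    fix m m' assume mm: "m \<in> M'" "m' \<in> M'"
    show "g m = g m' \<longleftrightarrow> m = m'"
    proof
      assume eq: "g m = g m'"
      have Q: "s \<in> SC \<and> length s = Suc (b k) \<and> (\<forall>u\<le>k. s!b u = g s!u) \<and>
          (\<forall>i. 1 \<le> i \<and> i < b k \<and> i \<notin> b ` {..k} \<longrightarrow> D s i)" if "s \<in> M'" for s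
        using that length_maxchain[of s] bk by (auto simp: M'_def maxchains_def g_def simp del: upt_Suc)
      have s: "m \<in> SC" "length m = Suc n" "m!0 = z"
        using mm(1) length_maxchain[of m] satchains_take_1[of m A le z] satchains_nonempty[of m A le z]
        by (auto simp: M'_def maxchains_def take_Suc hd_conv_nth)
      have le: "b v < length m" if "v \<le> k" for v using b_mono[OF that] bk s by simp
      have "g m!0 = z" "\<And>v. v \<le> k \<Longrightarrow> g m!v \<in> A" "\<And>j. j < k \<Longrightarrow> le (g m!j) (g m!Suc j)"
        "\<And>v. v \<le> k \<Longrightarrow> prank A le z (g m!v) = b v"
        using s le bk prank_nth[OF s(1) le] satchain_mono[OF s(1) b_mono le] satchains_subset[OF s(1)]
        by (auto simp: g_def subset_iff simp del: upt_Suc)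
      from ex1_chain_through_multichain[OF prefix uniq this order_refl]
      have "\<exists>!s. s \<in> SC \<and> length s = Suc (b k) \<and> (\<forall>u\<le>k. s!b u = g m!u) \<and>
          (\<forall>i. 1 \<le> i \<and> i < b k \<and> i \<notin> b ` {..k} \<longrightarrow> D s i)" by blast
      then show "m = m'" using Q[OF mm(1)] Q[OF mm(2)] unfolding eq by blast
    qed simp
  qed
  then have "Fflag A le z \<alpha> = int (card M')"
    using Fflag_eq_card_multichains[OF n] bij_betw_same_card by metis
  also have "M' = {m \<in> MC. \<forall>j\<in>{i \<in> {1..<n}. \<not> D m i}. 1 \<le> j \<and> j < n \<longrightarrow> w!(j - 1) < w!j}"
  proof -
    have "w!(j - 1) < w!j \<longleftrightarrow> j \<in> b ` {..k}" if "1 \<le> j" "j < n" for j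
    proof -
      \<comment> \<open>The partial sums reach \<open>n\<close> at \<open>k\<close>, so one that is
        smaller than \<open>n\<close> occurs earlier.\<close>
      have "v \<le> k" if "b v = j" for v
        using b_mono[of k v] that \<open>j < n\<close> bk by (meson leD nat_le_linear)
      then show ?thesis using qsym_word_ascent_iff[OF w that, folded b_def] by auto
    qed
    then show ?thesis unfolding M'_def by auto
  qed
  also have "int (card \<dots>) = (\<Sum>m\<in>MC. Lfun {i \<in> {1..<n}. \<not> D m i} n \<alpha>)"
    using finite_maxchains by (simp only: Lfun_word[OF w]) (simp add: sum.If_cases Int_def)
  finally show ?thesis .
qed

end

section \<open>Quadratic exchanges\<close>

text \<open>The transposition of positions \<open>i - 1\<close> and \<open>i\<close> of a label
  word. Labels are numbered from 0, so these are the labels of the two covers that meet at rank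
  \<open>i\<close>.\<close>

definition swap_adj :: "nat \<Rightarrow> nat \<Rightarrow> nat" where
  "swap_adj i j = (if j = i - 1 then i else if j = i then i - 1 else j)"

lemma swap_adj_commute: "1 \<le> i \<Longrightarrow> Suc i < j \<Longrightarrow> swap_adj i (swap_adj j l) = swap_adj j (swap_adj i l)"
  by (auto simp: swap_adj_def)

lemma swap_adj_idem: "1 \<le> i \<Longrightarrow> swap_adj i (swap_adj i j) = j"
  by (simp add: swap_adj_def)

text \<open>The non-inversions of a label word. Labels are only partially ordered, and incomparable
  pairs do not count.\<close>

definition ascending_pairs :: "nat \<Rightarrow> (nat \<Rightarrow> 'l::order) \<Rightarrow> (nat \<times> nat) set" where
  "ascending_pairs N f = {(j, k). j < k \<and> k < N \<and> f j < f k}"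

lemma finite_ascending_pairs: "finite (ascending_pairs N f)"
  by (rule finite_subset[of _ "{..<N} \<times> {..<N}"]) (auto simp: ascending_pairs_def)

text \<open>The transposition reverses the order of no pair of positions except
  \<open>(i - 1, i)\<close>, which does not ascend after the swap. It therefore embeds the new
  ascending pairs into the old ones, and \<open>(i - 1, i)\<close> is missed.\<close>

lemma card_ascending_pairs_swap_less:
  assumes i: "1 \<le> i" "i < N" and asc: "f (i - 1) < f i"
    and g: "\<And>j. j < N \<Longrightarrow> g j = f (swap_adj i j)"
  shows "card (ascending_pairs N g) < card (ascending_pairs N f)"
proof -
  let ?h = "\<lambda>(j, k). (swap_adj i j, swap_adj i k)"
  have mem: "(i - 1, i) \<in> ascending_pairs N f"
    using i asc by (simp add: ascending_pairs_def)
  have "inj_on ?h (ascending_pairs N g)"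
    using i by (intro inj_on_inverseI[where g = ?h]) (auto simp: swap_adj_idem)
  moreover have "?h ` ascending_pairs N g \<subseteq> ascending_pairs N f - {(i - 1, i)}"
  proof (clarsimp simp: ascending_pairs_def)
    fix j k assume jk: "j < k" "k < N" "g j < g k"
    then have lt: "f (swap_adj i j) < f (swap_adj i k)" using g by simp
    have "\<not> (j = i - 1 \<and> k = i)"
      using lt asc i by (auto simp: swap_adj_def split: if_splits dest: less_asym)
    then show "swap_adj i j < swap_adj i k \<and> swap_adj i k < N \<and>
        f (swap_adj i j) < f (swap_adj i k) \<and> (swap_adj i j = i - Suc 0 \<longrightarrow> swap_adj i k \<noteq> i)"
      using jk i lt by (auto simp: swap_adj_def split: if_splits)
  qed
  ultimately have "card (ascending_pairs N g) \<le> card (ascending_pairs N f - {(i - 1, i)})"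
    using finite_ascending_pairs by (metis card_inj_on_le finite_Diff)
  also have "\<dots> < card (ascending_pairs N f)"
    using mem finite_ascending_pairs by (metis card_Diff1_less)
  finally show ?thesis .
qed

locale gen_CW = graded A le z n
  for A :: "'a set" and le :: "'a \<Rightarrow> 'a \<Rightarrow> bool" and z :: 'a and n :: nat +
  fixes lam :: "'a list \<Rightarrow> nat \<Rightarrow> 'l::order"
  assumes gen_CW: "gen_CW_labeling A le z lam"
begin

abbreviation "slam \<equiv> slab A le z lam"
abbreviation "US \<equiv> Usat A le z lam"
abbreviation "UM \<equiv> Umax A le z lam"

section \<open>Labels and exchanges on saturated chains, independent of the completion\<close>

lemma maxchain_satchain: "m \<in> MC \<Longrightarrow> m \<in> SC"
  by (simp add: maxchains_def)

text \<open>Label \<open>j\<close> involves the elements at positions \<open>j\<close> and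
  \<open>j + 1\<close>, so \<open>k\<close> common elements contain \<open>k - 1\<close> common
  covers; this is the \<open>d\<close> of \<open>C_labeling\<close>.\<close>

lemma lam_prefix:
  assumes "m \<in> MC" "m' \<in> MC" "take k m = take k m'" "Suc j < k"
  shows "lam m j = lam m' j"
proof -
  have "C_labeling A le z lam"
    using gen_CW by (simp add: gen_CW_labeling_def CR_labeling_def)
  moreover have "take (Suc (k - 1)) m = take (Suc (k - 1)) m'" "j < k - 1" using assms by simp_all
  ultimately show ?thesis using assms(1,2) unfolding C_labeling_def by blast
qed

lemma some_maxchain:
  assumes "c \<in> SC"
  shows "(SOME m. m \<in> MC \<and> take (length c) m = c) \<in> MC"
    and "take (length c) (SOME m. m \<in> MC \<and> take (length c) m = c) = c"
proof -
  have "\<exists>m. m \<in> MC \<and> take (length c) m = c" using ex_maxchain[OF assms] by metis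
  from someI_ex[OF this] show "(SOME m. m \<in> MC \<and> take (length c) m = c) \<in> MC"
    and "take (length c) (SOME m. m \<in> MC \<and> take (length c) m = c) = c" by auto
qed

text \<open>Removes the choice in \<open>slab\<close>: every completion of \<open>c\<close> gives
  the same labels.\<close>

lemma slab_eq:
  assumes "c \<in> SC" "m \<in> MC" "take (length c) m = c" "Suc j < length c"
  shows "slam c j = lam m j"
  unfolding slab_def
  using lam_prefix[OF some_maxchain(1)[OF assms(1)] assms(2) _ assms(4)]
    some_maxchain(2)[OF assms(1)] assms(3) by simp

lemma ascent_slab_maxchain: "m \<in> MC \<Longrightarrow> ascent slam m i \<longleftrightarrow> ascent lam m i"
  using slab_eq[of m m i] slab_eq[of m m "i - 1"] maxchain_satchain by (auto simp: ascent_def)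

lemma ex1_switch:
  assumes "m \<in> MC" "ascent lam m i"
  shows "\<exists>!x. x \<noteq> m!i \<and> swap_ok A le z lam m i x"
  using gen_CW assms unfolding gen_CW_labeling_def rank_two_switching_def by blast

lemma switch_unique:
  assumes "m \<in> MC" "m' \<in> MC" "ascent lam m i" "take (Suc (Suc i)) m = take (Suc (Suc i)) m'"
    "x \<noteq> m!i" "swap_ok A le z lam m i x" "x' \<noteq> m'!i" "swap_ok A le z lam m' i x'"
  shows "x = x'"
proof -
  have "\<forall>m\<in>MC. \<forall>m'\<in>MC. \<forall>i x x'. ascent lam m i \<and> take (Suc (Suc i)) m = take (Suc (Suc i)) m' \<and>
        x \<noteq> m!i \<and> swap_ok A le z lam m i x \<and> x' \<noteq> m'!i \<and> swap_ok A le z lam m' i x' \<longrightarrow> x = x'"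
    using gen_CW unfolding gen_CW_labeling_def rank_two_switching_def by (elim conjE) assumption
  from this[rule_format, OF assms(1,2), of i x x'] show ?thesis using assms(3-) by simp
qed

lemma Umax_ascent:
  assumes "m \<in> MC" "ascent lam m i"
  obtains x where "x \<noteq> m!i" "swap_ok A le z lam m i x" "UM i m = m[i := x]"
proof -
  let ?x = "THE x. x \<noteq> m!i \<and> swap_ok A le z lam m i x"
  show ?thesis
    using theI'[OF ex1_switch[OF assms]] assms(2) by (intro that[of ?x]) (auto simp: Umax_def)
qed

lemma Umax_no_ascent: "\<not> ascent lam m i \<Longrightarrow> UM i m = m"
  by (simp add: Umax_def)

lemma Umax_eqI:
  assumes "m \<in> MC" "ascent lam m i" "x \<noteq> m!i" "swap_ok A le z lam m i x"
  shows "UM i m = m[i := x]"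
  using Umax_ascent[OF assms(1,2)] ex1_switch[OF assms(1,2)] assms(3,4) by metis

lemma Umax_in_maxchains: "m \<in> MC \<Longrightarrow> UM i m \<in> MC"
  by (metis Umax_ascent Umax_no_ascent swap_ok_def)

lemma Umax_neq: "m \<in> MC \<Longrightarrow> ascent lam m i \<Longrightarrow> UM i m \<noteq> m"
  by (metis Umax_ascent ascent_def Suc_lessD nth_list_update_eq)

lemma swap_ok_label:
  assumes "swap_ok A le z lam m i x" "1 \<le> i" "Suc j < length m"
  shows "lam (m[i := x]) j = lam m (swap_adj i j)"
  using assms by (auto simp: swap_ok_def swap_adj_def)

lemma swap_okI:
  assumes "m[i := x] \<in> MC" "1 \<le> i" "Suc i < length m"
    and "\<And>j. Suc j < length m \<Longrightarrow> lam (m[i := x]) j = lam m (swap_adj i j)"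
  shows "swap_ok A le z lam m i x"
  unfolding swap_ok_def using assms(1-3) assms(4)[of i] assms(4)[of "i - 1"] assms(4)
  by (simp add: swap_adj_def)

lemma lam_Umax:
  assumes "m \<in> MC" "ascent lam m i" "Suc j < length m"
  shows "lam (UM i m) j = lam m (swap_adj i j)"
  using Umax_ascent[OF assms(1,2)] swap_ok_label assms(2,3) by (metis ascent_def)

lemma ascent_prefix:
  assumes "m \<in> MC" "m' \<in> MC" "take k m = take k m'" "Suc i < k"
  shows "ascent lam m i \<longleftrightarrow> ascent lam m' i"
  using lam_prefix[OF assms(1-3), of i] lam_prefix[OF assms(1-3), of "i - 1"] assms
    length_maxchain[OF assms(1)] length_maxchain[OF assms(2)] by (auto simp: ascent_def)

text \<open>This is where the locality clause of rank two switching enters: the new element depends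
  only on the members up to rank \<open>i + 1\<close>. It lets the exchange descend to saturated
  chains.\<close>

lemma Umax_prefix:
  assumes "m \<in> MC" "m' \<in> MC" "take k m = take k m'" "Suc i < k"
  shows "take k (UM i m) = take k (UM i m')"
proof (cases "ascent lam m i")
  case True
  then have True': "ascent lam m' i" using ascent_prefix[OF assms] by simp
  obtain x where x: "x \<noteq> m!i" "swap_ok A le z lam m i x" "UM i m = m[i := x]"
    using Umax_ascent[OF assms(1) True] by metis
  obtain x' where x': "x' \<noteq> m'!i" "swap_ok A le z lam m' i x'" "UM i m' = m'[i := x']"
    using Umax_ascent[OF assms(2) True'] by metis
  have "take (Suc (Suc i)) m = take (Suc (Suc i)) m'"
    using assms(3,4) by (metis Suc_leI min.absorb1 take_take)
  then have "x = x'" using switch_unique[OF assms(1,2) True _ x(1,2) x'(1,2)] by simp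
  then show ?thesis using x x' assms(3) by (simp add: take_update_swap)
next
  case False
  then show ?thesis using ascent_prefix[OF assms] assms(3) by (simp add: Umax_no_ascent)
qed

lemma Usat_eq:
  assumes "c \<in> SC" "m \<in> MC" "take (length c) m = c" "Suc i < length c"
  shows "US i c = take (length c) (UM i m)"
proof (cases "1 \<le> i")
  case True
  then show ?thesis
    unfolding Usat_def using Umax_prefix[OF some_maxchain(1)[OF assms(1)] assms(2) _ assms(4)]
      some_maxchain(2)[OF assms(1)] assms(3,4) by simp
next
  case False
  then show ?thesis using assms(3) by (simp add: Usat_def Umax_def ascent_def)
qed

lemma Usat_trivial: "length c \<le> Suc i \<Longrightarrow> US i c = c"
  by (simp add: Usat_def)

lemma ascent_slab_eq:
  assumes "c \<in> SC" "m \<in> MC" "take (length c) m = c" "Suc i < length c"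
  shows "ascent slam c i \<longleftrightarrow> ascent lam m i"
proof -
  have "length c \<le> length m" using assms(3) by (metis length_take min.cobounded1)
  then show ?thesis
    using slab_eq[OF assms] slab_eq[OF assms(1-3), of "i - 1"] assms(4) by (auto simp: ascent_def)
qed

lemma Usat_no_ascent:
  assumes "c \<in> SC" "\<not> ascent slam c i"
  shows "US i c = c"
proof (cases "Suc i < length c")
  case True
  obtain m where m: "m \<in> MC" "take (length c) m = c" using ex_maxchain assms(1) by metis
  then show ?thesis
    using Usat_eq[OF assms(1) m True] ascent_slab_eq[OF assms(1) m True] assms(2) Umax_no_ascent by simp
qed (simp add: Usat_trivial)

lemma Usat_ascent:
  assumes "c \<in> SC" "ascent slam c i"
  obtains x where "x \<noteq> c!i" "US i c = c[i := x]"
proof -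
  have i: "Suc i < length c" using assms(2) by (simp add: ascent_def)
  obtain m where m: "m \<in> MC" "take (length c) m = c" using ex_maxchain assms(1) by metis
  obtain x where x: "x \<noteq> m!i" "UM i m = m[i := x]"
    using Umax_ascent[OF m(1)] ascent_slab_eq[OF assms(1) m i] assms(2) by metis
  have "m!i = c!i" using m(2) i by (metis Suc_lessD nth_take)
  then show ?thesis
    using that[of x] x Usat_eq[OF assms(1) m i] m(2) by (simp add: take_update_swap)
qed

lemma Usat_in_satchains: "c \<in> SC \<Longrightarrow> US i c \<in> SC"
proof (cases "Suc i < length c")
  case True
  assume c: "c \<in> SC"
  obtain m where m: "m \<in> MC" "take (length c) m = c" using ex_maxchain c by metis
  show ?thesis
    unfolding Usat_eq[OF c m True]
    using True Umax_in_maxchains[OF m(1)] by (intro satchains_take maxchain_satchain) auto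
qed (simp add: Usat_trivial)

lemma length_Usat: "c \<in> SC \<Longrightarrow> length (US i c) = length c"
  by (metis Usat_ascent Usat_no_ascent length_list_update)

lemma last_Usat: "c \<in> SC \<Longrightarrow> last (US i c) = last c"
proof (cases "ascent slam c i")
  case True
  assume c: "c \<in> SC"
  then obtain x where "US i c = c[i := x]" using True Usat_ascent by metis
  then show ?thesis using True c satchains_nonempty[OF c] by (auto simp: ascent_def last_list_update)
qed (simp add: Usat_no_ascent)

lemma take_Usat_le: "c \<in> SC \<Longrightarrow> k \<le> i \<Longrightarrow> take k (US i c) = take k c"
  by (metis Usat_ascent Usat_no_ascent take_update_cancel)

lemma Usat_append:
  assumes "c \<in> SC" "c @ e \<in> SC" "Suc i < length c"
  shows "US i (c @ e) = US i c @ e" and "ascent slam (c @ e) i \<longleftrightarrow> ascent slam c i"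
proof -
  obtain m where m: "m \<in> MC" "take (length (c @ e)) m = c @ e" using ex_maxchain assms(2) by metis
  then have mc: "take (length c) m = c"
    by (metis append_eq_conv_conj length_append min.absorb1 le_add1 take_take)
  have i: "Suc i < length (c @ e)" using assms(3) by simp
  show asc: "ascent slam (c @ e) i \<longleftrightarrow> ascent slam c i"
    using ascent_slab_eq[OF assms(2) m i] ascent_slab_eq[OF assms(1) m(1) mc assms(3)] by simp
  show "US i (c @ e) = US i c @ e"
  proof (cases "ascent slam c i")
    case True
    then obtain x where x: "UM i m = m[i := x]"
      using Umax_ascent[OF m(1)] ascent_slab_eq[OF assms(1) m(1) mc assms(3)] by metis
    then have "US i (c @ e) = (c @ e)[i := x]" "US i c = c[i := x]"
      using Usat_eq[OF assms(2) m i] Usat_eq[OF assms(1) m(1) mc assms(3)] m(2) mc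
      by (simp_all add: take_update_swap)
    then show ?thesis using assms(3) by (simp add: list_update_append)
  qed (use asc assms Usat_no_ascent in simp)
qed

lemma ascent_take:
  assumes "c \<in> SC" "Suc i < k" "k \<le> length c"
  shows "ascent slam (take k c) i \<longleftrightarrow> ascent slam c i"
proof -
  have "take k c \<in> SC" using assms by (intro satchains_take) auto
  then show ?thesis
    using Usat_append(2)[of "take k c" "drop k c" i] assms by simp
qed

lemma slab_Usat:
  assumes "c \<in> SC" "ascent slam c i" "Suc j < length c"
  shows "slam (US i c) j = slam c (swap_adj i j)"
proof -
  have i: "1 \<le> i" "Suc i < length c" using assms(2) by (simp_all add: ascent_def)
  obtain m where m: "m \<in> MC" "take (length c) m = c" using ex_maxchain assms(1) by metis
  have U: "take (length (US i c)) (UM i m) = US i c"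
    unfolding length_Usat[OF assms(1)] using Usat_eq[OF assms(1) m i(2)] by simp
  have lt: "Suc (swap_adj i j) < length c" using i assms(3) by (auto simp: swap_adj_def)
  have "slam (US i c) j = lam (UM i m) j"
    using slab_eq[OF Usat_in_satchains[OF assms(1)] Umax_in_maxchains[OF m(1)] U] assms(1,3)
    by (simp add: length_Usat)
  also have "\<dots> = lam m (swap_adj i j)"
  proof (rule lam_Umax[OF m(1)])
    show "ascent lam m i" using ascent_slab_eq[OF assms(1) m i(2)] assms(2) by simp
    show "Suc j < length m" using assms(3) m(2) by (metis length_take min_less_iff_conj)
  qed
  also have "\<dots> = slam c (swap_adj i j)" using slab_eq[OF assms(1) m lt] by simp
  finally show ?thesis .
qed

text \<open>The two exchanges affect disjoint pairs of labels. The clauses of rank two switching are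
  used asymmetrically: locality handles the lower exchange after the upper one, whereas in the other
  order the prefix has changed and only the uniqueness of the switching element applies.\<close>

lemma Umax_commute:
  assumes m: "m \<in> MC" and asc: "ascent lam m i" "ascent lam m j" and ij: "Suc i < j"
  shows "UM i (UM j m) = UM j (UM i m)"
proof -
  obtain x where x: "x \<noteq> m!i" "swap_ok A le z lam m i x" "UM i m = m[i := x]"
    using Umax_ascent[OF m asc(1)] by metis
  obtain y where y: "y \<noteq> m!j" "swap_ok A le z lam m j y" "UM j m = m[j := y]"
    using Umax_ascent[OF m asc(2)] by metis
  have mx: "m[i := x] \<in> MC" and my: "m[j := y] \<in> MC"
    using x y by (simp_all add: swap_ok_def)
  have i: "1 \<le> i" "Suc i < length m" and j: "1 \<le> j" "Suc j < length m"
    using asc by (simp_all add: ascent_def)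
  have swap: "swap_adj j i = i" "swap_adj j (i - 1) = i - 1" "swap_adj i j = j" "swap_adj i (j - 1) = j - 1"
    using ij by (simp_all add: swap_adj_def) linarith+
  have asc_i: "ascent lam (m[j := y]) i"
    using asc(1) swap_ok_label[OF y(2) j(1), of i] swap_ok_label[OF y(2) j(1), of "i - 1"] i swap
    by (simp add: ascent_def)
  have asc_j: "ascent lam (m[i := x]) j"
    using asc(2) swap_ok_label[OF x(2) i(1), of j] swap_ok_label[OF x(2) i(1), of "j - 1"] j swap
    by (simp add: ascent_def)
  obtain x' where x': "x' \<noteq> m[j := y]!i" "swap_ok A le z lam (m[j := y]) i x'"
    "UM i (m[j := y]) = m[j := y, i := x']"
    using Umax_ascent[OF my asc_i] by metis
  \<comment> \<open>The replacement at \<open>j\<close> lies above rank \<open>i + 1\<close>, so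
    locality forces the same new element at \<open>i\<close>.\<close>
  have "take (Suc (Suc i)) m = take (Suc (Suc i)) (m[j := y])" using ij by simp
  then have "x' = x" using switch_unique[OF m my asc(1) _ x(1,2) x'(1,2)] by simp
  then have M: "m[j := y, i := x] \<in> MC"
    and lab: "\<And>l. Suc l < length m \<Longrightarrow> lam (m[j := y, i := x]) l = lam m (swap_adj j (swap_adj i l))"
    using x'(2) swap_ok_label[OF x'(2) i(1)] swap_ok_label[OF y(2) j(1)] i
    by (auto simp: swap_ok_def swap_adj_def)
  have comm: "m[j := y, i := x] = m[i := x, j := y]" using ij by (simp add: list_update_swap)
  \<comment> \<open>The chain with both replacements is already known to be maximal, with both label
    swaps performed. Read from \<open>m[i := x]\<close>, it exhibits \<open>y\<close> as a
    legitimate switch at \<open>j\<close>, and uniqueness identifies it with the exchange.\<close>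
  have "swap_ok A le z lam (m[i := x]) j y"
  proof (rule swap_okI)
    show "m[i := x, j := y] \<in> MC" using M comm by simp
    show "1 \<le> j" "Suc j < length (m[i := x])" using j by simp_all
    fix l assume l: "Suc l < length (m[i := x])"
    then have "Suc (swap_adj j l) < length m" using j by (auto simp: swap_adj_def)
    then have "lam (m[i := x]) (swap_adj j l) = lam m (swap_adj i (swap_adj j l))"
      by (rule swap_ok_label[OF x(2) i(1)])
    also have "swap_adj i (swap_adj j l) = swap_adj j (swap_adj i l)"
      using i(1) ij by (rule swap_adj_commute)
    finally show "lam (m[i := x, j := y]) l = lam (m[i := x]) (swap_adj j l)"
      using lab[of l] l comm by simp
  qed
  then have "UM j (m[i := x]) = m[i := x, j := y]"
    using Umax_eqI[OF mx asc_j, of y] y(1) ij by simp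
  then show ?thesis using x y x' \<open>x' = x\<close> comm by simp
qed

lemma Usat_commute:
  assumes c: "c \<in> SC" and asc: "ascent slam c i" "ascent slam c j" and ij: "Suc i < j"
  shows "US i (US j c) = US j (US i c)"
proof -
  have i: "Suc i < length c" and j: "Suc j < length c" using asc by (simp_all add: ascent_def)
  obtain m where m: "m \<in> MC" "take (length c) m = c" using ex_maxchain c by metis
  have "US l' (US l c) = take (length c) (UM l' (UM l m))" if "Suc l < length c" "Suc l' < length c" for l l'
  proof -
    have U: "take (length (US l c)) (UM l m) = US l c"
      unfolding length_Usat[OF c] using Usat_eq[OF c m that(1)] by simp
    show ?thesis
      using Usat_eq[OF Usat_in_satchains[OF c] Umax_in_maxchains[OF m(1)] U] that(2)
      unfolding length_Usat[OF c] by simp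
  qed
  then show ?thesis
    using Umax_commute[OF m(1) _ _ ij] ascent_slab_eq[OF c m] asc i j by simp
qed

lemma Usat_braid:
  assumes "c \<in> SC" "ascent slam c i" "ascent slam c (Suc i)"
  shows "US i (US (Suc i) (US i c)) = US (Suc i) (US i (US (Suc i) c))"
proof -
  have "braid_property A le z lam" using gen_CW by (simp add: gen_CW_labeling_def)
  then show ?thesis using assms unfolding braid_property_def ascent_def by simp
qed

text \<open>Unlike \<open>rstep\<close>, this keeps only exchanges at genuine ascents; trivial steps
  from a chain to itself would destroy termination. The root occupies the positions below
  \<open>length r\<close>, which remain untouched.\<close>

definition raises :: "'a list \<Rightarrow> ('a list \<times> 'a list) set" where
  "raises r = {(s, US i s) |s i. s \<in> SC \<and> take (length r) s = r \<and> length r \<le> i \<and> ascent slam s i}"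

lemma wf_raises: "wf ((raises r)\<inverse>)"
proof (rule wf_subset)
  let ?f = "\<lambda>s. card (ascending_pairs (length s - 1) (slam s))"
  show "(raises r)\<inverse> \<subseteq> measure ?f"
  proof (clarsimp simp: raises_def)
    fix s i assume s: "s \<in> SC" and asc: "ascent slam s i"
    show "card (ascending_pairs (length (US i s) - Suc 0) (slam (US i s)))
        < card (ascending_pairs (length s - Suc 0) (slam s))"
      using card_ascending_pairs_swap_less[of i "length s - 1" "slam s" "slam (US i s)"]
        slab_Usat[OF s asc] asc s by (simp add: length_Usat ascent_def less_diff_conv)
  qed
qed simp

lemma rooted_Usat:
  assumes "s \<in> SC" "take (length r) s = r" "length r \<le> i"
  shows "US i s \<in> SC" "take (length r) (US i s) = r" "length (US i s) = length s" "last (US i s) = last s"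
  using assms Usat_in_satchains length_Usat last_Usat take_Usat_le by auto

lemma raises_step:
  assumes "s \<in> SC" "take (length r) s = r" "length r \<le> i"
  shows "(s, US i s) \<in> (raises r)\<^sup>*"
proof (cases "ascent slam s i")
  case True
  then show ?thesis using assms by (auto simp: raises_def)
qed (simp add: assms Usat_no_ascent)

lemma raises_locally_confluent:
  assumes "(s, a) \<in> raises r" "(s, b) \<in> raises r"
  shows "\<exists>d. (a, d) \<in> (raises r)\<^sup>* \<and> (b, d) \<in> (raises r)\<^sup>*"
proof -
  obtain i j where s: "s \<in> SC" "take (length r) s = r" and i: "length r \<le> i" "ascent slam s i" "a = US i s"
    and j: "length r \<le> j" "ascent slam s j" "b = US j s"
    using assms by (auto simp: raises_def)
  have braid: "\<exists>d. (US i s, d) \<in> (raises r)\<^sup>* \<and> (US (Suc i) s, d) \<in> (raises r)\<^sup>*"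
    if "length r \<le> i" "ascent slam s i" "ascent slam s (Suc i)" for i
  proof -
    \<comment> \<open>The later exchanges are followed in the reflexive closure, so the ascents at
      the intermediate chains need not be traced.\<close>
    have "(US k s, US k' (US l (US k s))) \<in> (raises r)\<^sup>*" if k: "length r \<le> k" "length r \<le> l" "length r \<le> k'" for k l k'
    proof -
      note k1 = rooted_Usat[OF s k(1)]
      note k2 = rooted_Usat[OF k1(1,2) k(2)]
      show ?thesis using raises_step[OF k1(1,2) k(2)] raises_step[OF k2(1,2) k(3)] by (rule rtrancl_trans)
    qed
    then have "(US i s, US i (US (Suc i) (US i s))) \<in> (raises r)\<^sup>*"
      "(US (Suc i) s, US (Suc i) (US i (US (Suc i) s))) \<in> (raises r)\<^sup>*"
      using that(1) by auto
    then show ?thesis using Usat_braid[OF s(1) that(2,3)] by auto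
  qed
  have far: "\<exists>d. (US i s, d) \<in> (raises r)\<^sup>* \<and> (US j s, d) \<in> (raises r)\<^sup>*"
    if "length r \<le> i" "ascent slam s i" "ascent slam s j" "Suc i < j" for i j
  proof -
    have "length r \<le> j" using that by simp
    then have "(US i s, US j (US i s)) \<in> (raises r)\<^sup>*" "(US j s, US i (US j s)) \<in> (raises r)\<^sup>*"
      using raises_step rooted_Usat[OF s] that(1) by auto
    then show ?thesis using Usat_commute[OF s(1) that(2,3,4)] by auto
  qed
  consider "i = j" | "j = Suc i" | "i = Suc j" | "Suc i < j" | "Suc j < i" by linarith
  then show ?thesis
  proof cases
    case 1
    then show ?thesis using i j by auto
  next
    case 2
    then show ?thesis using braid[of i] i j by auto
  next
    case 3
    then show ?thesis using braid[of j] i j by auto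
  next
    case 4
    then show ?thesis using far[of i j] i j by auto
  next
    case 5
    then show ?thesis using far[of j i] i j by auto
  qed
qed

text \<open>The two relations differ only by loops, which the reflexive closure absorbs. So
  \<open>requiv\<close> is convertibility for the terminating relation.\<close>

lemma rstep_rtrancl_eq:
  "(rstep A le z lam r \<union> (rstep A le z lam r)\<inverse>)\<^sup>* = (raises r \<union> (raises r)\<inverse>)\<^sup>*"
proof (rule rtrancl_subset)
  show "raises r \<union> (raises r)\<inverse> \<subseteq> rstep A le z lam r \<union> (rstep A le z lam r)\<inverse>"
    by (auto simp: raises_def rstep_def ascent_def)
  have "rstep A le z lam r \<subseteq> (raises r)\<^sup>="
  proof
    fix p assume "p \<in> rstep A le z lam r"
    then obtain s i where s: "p = (s, US i s)" "s \<in> SC" "take (length r) s = r" "length r \<le> i"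
      unfolding rstep_def by blast
    then show "p \<in> (raises r)\<^sup>="
      using Usat_no_ascent[OF s(2), of i] unfolding raises_def by (cases "ascent slam s i") auto
  qed
  then show "rstep A le z lam r \<union> (rstep A le z lam r)\<inverse> \<subseteq> (raises r \<union> (raises r)\<inverse>)\<^sup>*"
    by auto
qed

lemma raises_conv_rooted:
  assumes "(s, s') \<in> (raises r \<union> (raises r)\<inverse>)\<^sup>*" "s \<in> SC" "take (length r) s = r"
  shows "s' \<in> SC \<and> take (length r) s' = r \<and> last s' = last s \<and> length s' = length s"
  using assms
proof (induction rule: rtrancl_induct)
  case (step a b)
  then show ?case using rooted_Usat by (auto simp: raises_def)
qed simp

lemma requiv_iff:
  "requiv A le z lam r s s' \<longleftrightarrow>
    s \<in> SC \<and> take (length r) s = r \<and> (s, s') \<in> (raises r \<union> (raises r)\<inverse>)\<^sup>*"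
  unfolding requiv_def rstep_rtrancl_eq using raises_conv_rooted[of s s' r] by auto

text \<open>Within the class, being irreducible for \<open>raises r\<close> means having no ascent
  strictly above the root, so this is the unique normal form.\<close>

lemma ex1_ascent_free:
  assumes "s \<in> SC" "take (length r) s = r"
  shows "\<exists>!s'. requiv A le z lam r s s' \<and> (\<forall>i. length r \<le> i \<and> Suc i < length s' \<longrightarrow> \<not> ascent slam s' i)"
proof -
  have "s' \<notin> Domain (raises r) \<longleftrightarrow> (\<forall>i. length r \<le> i \<and> Suc i < length s' \<longrightarrow> \<not> ascent slam s' i)"
    if "(s, s') \<in> (raises r \<union> (raises r)\<inverse>)\<^sup>*" for s'
  proof -
    have "s' \<in> Domain (raises r) \<longleftrightarrow> (\<exists>i. length r \<le> i \<and> ascent slam s' i)"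
      using raises_conv_rooted[OF that assms] unfolding raises_def by blast
    then show ?thesis by (auto simp: ascent_def)
  qed
  then have "requiv A le z lam r s s' \<and> (\<forall>i. length r \<le> i \<and> Suc i < length s' \<longrightarrow> \<not> ascent slam s' i) \<longleftrightarrow>
      (s, s') \<in> (raises r \<union> (raises r)\<inverse>)\<^sup>* \<and> s' \<notin> Domain (raises r)" for s'
    using assms unfolding requiv_iff by blast
  then show ?thesis
    using unique_normal_form[OF wf_raises raises_locally_confluent] by simp
qed

section \<open>Fixed chains, and the two functions attached to the poset\<close>

lemma Uword_fixed_iff:
  assumes "m \<in> MC"
  shows "Uword A le z lam ws m = m \<longleftrightarrow> (\<forall>i\<in>set ws. \<not> ascent lam m i)"
proof -
  let ?f = "\<lambda>m. card (ascending_pairs n (lam m))"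
  have dec: "?f (UM i m) < ?f m" if "m \<in> MC" "ascent lam m i" for m i
    using card_ascending_pairs_swap_less[of i n "lam m" "lam (UM i m)"]
      lam_Umax[OF that] that(2) length_maxchain[OF that(1)] by (simp add: ascent_def)
  have inv: "Uword A le z lam ws m \<in> MC \<and> (Uword A le z lam ws m = m \<or> ?f (Uword A le z lam ws m) < ?f m)" for ws
  proof (induction ws)
    case (Cons i ws)
    let ?m = "Uword A le z lam ws m"
    have "Uword A le z lam (i # ws) m = UM i ?m" by (simp add: Uword_def)
    moreover have "UM i ?m \<in> MC" using Cons Umax_in_maxchains by simp
    moreover have "UM i ?m = m \<or> ?f (UM i ?m) < ?f m"
    proof (cases "ascent lam ?m i")
      case True
      then have "?f (UM i ?m) < ?f ?m" using dec Cons by simp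
      then show ?thesis using Cons by auto
    next
      case False
      then show ?thesis using Cons by (simp add: Umax_no_ascent)
    qed
    ultimately show ?case by simp
  qed (simp add: Uword_def assms)
  show ?thesis
  proof (induction ws)
    case (Cons i ws)
    let ?m = "Uword A le z lam ws m"
    have U: "Uword A le z lam (i # ws) m = UM i ?m" by (simp add: Uword_def)
    show ?case
    proof
      assume fixed: "Uword A le z lam (i # ws) m = m"
      \<comment> \<open>The head of the word acts last, by \<open>foldr\<close>. The count cannot
        rise again, so if the whole word fixes \<open>m\<close>, then its tail already does.\<close>
      have "?f m \<le> ?f ?m"
      proof (cases "ascent lam ?m i")
        case True
        then have "?f (UM i ?m) < ?f ?m" using dec inv[of ws] by simp
        then show ?thesis using fixed U by simp
      qed (use fixed U in \<open>simp add: Umax_no_ascent\<close>)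
      then have "?m = m" using inv[of ws] by auto
      then show "\<forall>i\<in>set (i # ws). \<not> ascent lam m i"
        using Cons fixed U Umax_neq[OF assms] by auto
    next
      assume "\<forall>i\<in>set (i # ws). \<not> ascent lam m i"
      then show "Uword A le z lam (i # ws) m = m" using Cons U Umax_no_ascent by simp
    qed
  qed (simp add: Uword_def)
qed

lemma charP_eq:
  assumes "set ws \<subseteq> {1..<n}"
  shows "charP A le z lam ws = int (card {m \<in> MC. set ws \<subseteq> {i \<in> {1..<n}. \<not> ascent lam m i}})"
proof -
  have "{m \<in> MC. Uword A le z lam ws m = m} = {m \<in> MC. set ws \<subseteq> {i \<in> {1..<n}. \<not> ascent lam m i}}"
    using Uword_fixed_iff assms by auto
  then show ?thesis by (simp add: charP_def)
qed

lemma qch_charP: "qch n (charP A le z lam) = (\<lambda>\<alpha>. \<Sum>m\<in>MC. Lfun {i \<in> {1..<n}. \<not> ascent lam m i} n \<alpha>)"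
  by (rule qch_card_fixed) (auto simp: finite_maxchains charP_eq)

text \<open>Restates the CR property by positions: an ascent at \<open>i\<close> compares the labels
  \<open>i - 1\<close> and \<open>i\<close>, hence the shift by one against
  \<open>increasing_from\<close>.\<close>

lemma ex1_increasing:
  assumes "r \<in> SC" "y \<in> A" "le (last r) y"
  shows "\<exists>!s. s \<in> SC \<and> take (length r) s = r \<and> last s = y \<and>
    (\<forall>i. length r \<le> i \<and> Suc i < length s \<longrightarrow> ascent slam s i)"
proof -
  have r: "1 \<le> length r" using satchains_nonempty[OF assms(1)] by (simp add: Suc_le_eq)
  have "increasing_from A le z lam r s \<longleftrightarrow> (\<forall>i. length r \<le> i \<and> Suc i < length s \<longrightarrow> ascent slam s i)" for s
  proof
    assume inc: "increasing_from A le z lam r s"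
    show "\<forall>i. length r \<le> i \<and> Suc i < length s \<longrightarrow> ascent slam s i"
    proof (intro allI impI)
      fix i assume i: "length r \<le> i \<and> Suc i < length s"
      then have "length r - 1 \<le> i - 1" "Suc (Suc (i - 1)) < length s" "Suc (i - 1) = i" using r by auto
      then have "slam s (i - 1) < slam s i" using inc unfolding increasing_from_def by metis
      then show "ascent slam s i" using i r by (simp add: ascent_def)
    qed
  next
    assume asc: "\<forall>i. length r \<le> i \<and> Suc i < length s \<longrightarrow> ascent slam s i"
    show "increasing_from A le z lam r s"
      unfolding increasing_from_def
    proof (intro allI impI)
      fix j assume "length r - 1 \<le> j \<and> Suc (Suc j) < length s"
      then show "slam s j < slam s (Suc j)" using asc[rule_format, of "Suc j"] by (auto simp: ascent_def)
    qed
  qed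
  moreover have "\<exists>!s. s \<in> SC \<and> take (length r) s = r \<and> last s = y \<and> increasing_from A le z lam r s"
    using gen_CW assms unfolding gen_CW_labeling_def CR_labeling_def by blast
  ultimately show ?thesis by simp
qed

lemma Fflag_P:
  assumes "1 \<le> n"
  shows "Fflag A le z \<alpha> = (\<Sum>m\<in>MC. Lfun {i \<in> {1..<n}. \<not> ascent lam m i} n \<alpha>)"
proof -
  have "Fflag A le z \<alpha> = (\<Sum>m\<in>MC. Lfun {i \<in> {1..<n}. \<not> ascent slam m i} n \<alpha>)"
    using assms ascent_take ex1_increasing by (rule Fflag_eq_sum_Lfun)
  then show ?thesis by (simp add: ascent_slab_maxchain cong: sum.cong)
qed

end

section \<open>The quotient poset\<close>

context gen_CW
begin

abbreviation "cls \<equiv> qclass A le z lam"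
abbreviation "QC \<equiv> Q_carrier A le z lam"
abbreviation "QL \<equiv> Q_le A le z lam"
abbreviation "QB \<equiv> Q_bot A le z lam"
abbreviation "req \<equiv> requiv A le z lam"

section \<open>Classes of saturated chains and their order\<close>

lemma requiv_refl: "s \<in> SC \<Longrightarrow> take (length r) s = r \<Longrightarrow> req r s s"
  by (simp add: requiv_iff)

lemma requiv_sym: "req r s s' \<Longrightarrow> req r s' s"
proof -
  have "sym ((raises r \<union> (raises r)\<inverse>)\<^sup>*)" by (rule sym_rtrancl) (auto simp: sym_def)
  then show "req r s s' \<Longrightarrow> req r s' s"
    using raises_conv_rooted[of s s' r] unfolding requiv_iff by (auto dest: symD)
qed

lemma requiv_trans: "req r s s' \<Longrightarrow> req r s' s'' \<Longrightarrow> req r s s''"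
  unfolding requiv_iff by (meson rtrancl_trans)

lemma requivD:
  assumes "req r s s'"
  shows "s \<in> SC" "s' \<in> SC" "take (length r) s = r" "take (length r) s' = r" "last s' = last s" "length s' = length s"
  using assms raises_conv_rooted[of s s' r] unfolding requiv_iff by auto

lemma mem_qclass_iff: "s' \<in> cls s \<longleftrightarrow> req [z] s s'"
  by (simp add: qclass_def)

lemma qclass_refl: "s \<in> SC \<Longrightarrow> s \<in> cls s"
  using satchains_take_1[of s A le z] by (simp add: mem_qclass_iff requiv_refl)

lemma qclass_eq_iff:
  assumes "s \<in> SC"
  shows "cls s = cls s' \<longleftrightarrow> req [z] s s'"
proof
  assume "cls s = cls s'"
  then show "req [z] s s'" using qclass_refl[OF assms] requiv_sym by (simp add: mem_qclass_iff)
next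
  assume "req [z] s s'"
  then show "cls s = cls s'"
    by (auto simp: mem_qclass_iff intro: requiv_trans requiv_trans[OF requiv_sym])
qed

lemma qclass_eqD: "s \<in> SC \<Longrightarrow> cls s = cls s' \<Longrightarrow> length s = length s' \<and> last s = last s'"
  using requivD(5,6) qclass_eq_iff by metis

lemma Q_carrierE:
  assumes "X \<in> QC"
  obtains c where "c \<in> SC" "X = cls c"
  using assms unfolding Q_carrier_def by auto

lemma qclass_in_carrier: "c \<in> SC \<Longrightarrow> cls c \<in> QC"
  by (simp add: Q_carrier_def)

lemma qtop_qclass: "c \<in> SC \<Longrightarrow> qtop (cls c) = last c"
  unfolding qtop_def using someI[of "\<lambda>d. d \<in> cls c" c] qclass_refl requivD(5)
  by (simp add: mem_qclass_iff)

lemma satchain_append_cong: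
  assumes "a @ e \<in> SC" "a \<in> SC" "b \<in> SC" "last a = last b"
  shows "b @ e \<in> SC"
  using assms satchains_append_iff[of a e A le z] satchains_append_iff[of b e A le z]
  by (simp add: satchains_nonempty)

text \<open>An exchange within \<open>c\<close> is not affected by what follows \<open>c\<close>.
  The order of the quotient can therefore be tested on any representative.\<close>

lemma requiv_append:
  assumes "req [z] c c'" "c @ e \<in> SC"
  shows "req [z] (c @ e) (c' @ e)"
proof -
  have step: "(a @ e, b @ e) \<in> raises [z]" if "(a, b) \<in> raises [z]" "a @ e \<in> SC" for a b
  proof -
    obtain i where i: "a \<in> SC" "take (length [z]) a = [z]" "length [z] \<le> i" "ascent slam a i" "b = US i a"
      using \<open>(a, b) \<in> raises [z]\<close> unfolding raises_def by blast
    have "US i (a @ e) = b @ e" "ascent slam (a @ e) i"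
      using Usat_append[OF i(1) that(2), of i] i by (auto simp: ascent_def)
    moreover have "take (length [z]) (a @ e) = [z]" using satchains_take_1[OF that(2)] by simp
    ultimately show ?thesis using i(3) that(2) unfolding raises_def by force
  qed
  have "(c, c') \<in> (raises [z] \<union> (raises [z])\<inverse>)\<^sup>*" "c \<in> SC" "take (length [z]) c = [z]"
    using assms(1) by (simp_all add: requiv_iff)
  then have "c' @ e \<in> SC \<and> (c @ e, c' @ e) \<in> (raises [z] \<union> (raises [z])\<inverse>)\<^sup>*"
  proof (induction rule: rtrancl_induct)
    case base
    then show ?case using assms(2) by simp
  next
    case (step a b)
    have a: "a \<in> SC" "last a = last c" using raises_conv_rooted[OF step.hyps(1) step.prems] by auto
    have "(c, b) \<in> (raises [z] \<union> (raises [z])\<inverse>)\<^sup>*" using step.hyps by (rule rtrancl_into_rtrancl)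
    then have b: "b \<in> SC" "last b = last c" using raises_conv_rooted step.prems by auto
    have ae: "a @ e \<in> SC" and conv: "(c @ e, a @ e) \<in> (raises [z] \<union> (raises [z])\<inverse>)\<^sup>*"
      using step.IH[OF step.prems] by auto
    have be: "b @ e \<in> SC" using satchain_append_cong[OF ae a(1) b(1)] a b by simp
    have "(a @ e, b @ e) \<in> raises [z] \<union> (raises [z])\<inverse>"
      using step.hyps(2) \<open>\<And>a b. (a, b) \<in> raises [z] \<Longrightarrow> a @ e \<in> SC \<Longrightarrow> (a @ e, b @ e) \<in> raises [z]\<close> ae be by auto
    then show ?case using be conv by (meson rtrancl_into_rtrancl)
  qed
  moreover have "take (length [z]) (c @ e) = [z]" using satchains_take_1[OF assms(2)] by simp
  ultimately show ?thesis using assms(2) by (simp add: requiv_iff)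
qed

text \<open>In a saturated chain from \<open>z\<close> the position of an element is its rank, so a
  common element occupies the same position in both chains.\<close>

lemma satchain_subset_prefix:
  assumes "c \<in> SC" "d \<in> SC" "set c \<subseteq> set d"
  shows "\<exists>e. d = c @ e"
proof -
  have nth: "i < length d \<and> d!i = c!i" if i: "i < length c" for i
  proof -
    obtain j where j: "j < length d" "c!i = d!j" using assms(3) i by (metis in_set_conv_nth nth_mem subsetD)
    then have "j = i" using prank_nth[OF assms(1) i] prank_nth[OF assms(2) j(1)] by simp
    then show ?thesis using j by simp
  qed
  have "length c - 1 < length c" using satchains_nonempty[OF assms(1)] by simp
  then have "length c \<le> length d" using nth by fastforce
  then have "take (length c) d = c" using nth by (intro nth_equalityI) auto
  then show ?thesis by (metis append_take_drop_id)
qed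

text \<open>A comparison witnessed by other representatives can be transported to the given
  \<open>c\<close>, because tails may be appended to any member of a class. Successive comparisons
  then concatenate their tails, and the transitive closure collapses.\<close>

lemma Q_le_iff:
  assumes "c \<in> SC"
  shows "QL (cls c) Y \<longleftrightarrow> (\<exists>e. c @ e \<in> SC \<and> Y = cls (c @ e))"
proof -
  define R where "R = {(X, Y). X \<in> QC \<and> Y \<in> QC \<and> (\<exists>c\<in>X. \<exists>d\<in>Y. set c \<subseteq> set d)}"
  have QL: "QL X Y \<longleftrightarrow> (X, Y) \<in> R\<^sup>+" for X Y by (simp add: Q_le_def R_def)
  have step: "\<exists>e. c @ e \<in> SC \<and> Y = cls (c @ e)" if c: "c \<in> SC" and R: "(cls c, Y) \<in> R" for c Y
  proof -
    obtain c' d where c': "c' \<in> cls c" and d: "d \<in> Y" and sub: "set c' \<subseteq> set d" and Y: "Y \<in> QC"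
      using R by (auto simp: R_def)
    obtain s where s: "s \<in> SC" "Y = cls s" using Q_carrierE[OF Y] by metis
    have cc: "req [z] c c'" and sd: "req [z] s d" using c' d s by (simp_all add: mem_qclass_iff)
    obtain e where e: "d = c' @ e"
      using satchain_subset_prefix[OF requivD(2)[OF cc] requivD(2)[OF sd] sub] by blast
    have "c' @ e \<in> SC" using requivD(2)[OF sd] e by simp
    then have ce: "req [z] (c' @ e) (c @ e)" using requiv_append[OF requiv_sym[OF cc]] by simp
    then have "c @ e \<in> SC" by (rule requivD(2))
    moreover have "Y = cls (c @ e)"
      using s e requiv_trans[OF sd] ce qclass_eq_iff by simp
    ultimately show ?thesis by blast
  qed
  show ?thesis
  proof
    assume "QL (cls c) Y"
    then have "(cls c, Y) \<in> R\<^sup>+" by (simp add: QL)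
    then show "\<exists>e. c @ e \<in> SC \<and> Y = cls (c @ e)"
    proof (induction rule: trancl_induct)
      case (base Y)
      then show ?case using step assms by blast
    next
      case (step Y Z)
      then obtain e where e: "c @ e \<in> SC" "Y = cls (c @ e)" by blast
      then obtain e' where "(c @ e) @ e' \<in> SC" "Z = cls ((c @ e) @ e')"
        using \<open>\<And>c Y. c \<in> SC \<Longrightarrow> (cls c, Y) \<in> R \<Longrightarrow> \<exists>e. c @ e \<in> SC \<and> Y = cls (c @ e)\<close>[OF e(1), of Z] step.hyps(2)
        by blast
      then show ?case by (intro exI[of _ "e @ e'"]) simp
    qed
  next
    assume "\<exists>e. c @ e \<in> SC \<and> Y = cls (c @ e)"
    then obtain e where e: "c @ e \<in> SC" "Y = cls (c @ e)" by blast
    have "set c \<subseteq> set (c @ e)" by simp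
    then have "(cls c, Y) \<in> R"
      using e qclass_refl[OF assms] qclass_refl[OF e(1)] qclass_in_carrier[OF assms] qclass_in_carrier[OF e(1)]
      unfolding R_def by blast
    then show "QL (cls c) Y" by (simp add: QL r_into_trancl)
  qed
qed

text \<open>Length is constant on a class, so it serves as rank, and a cover corresponds to a tail
  of one element.\<close>

lemma Q_covers_iff:
  assumes c: "c \<in> SC"
  shows "covers QC QL (cls c) Y \<longleftrightarrow> (\<exists>y. c @ [y] \<in> SC \<and> Y = cls (c @ [y]))"
proof
  assume cov: "covers QC QL (cls c) Y"
  then obtain e where e: "c @ e \<in> SC" "Y = cls (c @ e)" using Q_le_iff[OF c] by (auto simp: covers_def)
  have "e \<noteq> []" using cov e(2) unfolding covers_def by (metis append_Nil2)
  then obtain y e' where ye: "e = y # e'" by (cases e) auto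
  have cy: "c @ [y] \<in> SC"
    using satchains_take[OF e(1), of "Suc (length c)"] ye by simp
  have "QL (cls c) (cls (c @ [y]))" unfolding Q_le_iff[OF c] using cy by blast
  moreover have "QL (cls (c @ [y])) Y"
    unfolding Q_le_iff[OF cy] using e ye by (intro exI[of _ e']) simp
  moreover have "cls (c @ [y]) \<noteq> cls c" using qclass_eqD[OF cy, of c] by auto
  ultimately have "Y = cls (c @ [y])"
    using cov qclass_in_carrier[OF cy] unfolding covers_def by metis
  then show "\<exists>y. c @ [y] \<in> SC \<and> Y = cls (c @ [y])" using cy by blast
next
  assume "\<exists>y. c @ [y] \<in> SC \<and> Y = cls (c @ [y])"
  then obtain y where y: "c @ [y] \<in> SC" "Y = cls (c @ [y])" by blast
  show "covers QC QL (cls c) Y"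
    unfolding covers_def
  proof (intro conjI notI)
    show "cls c \<in> QC" "Y \<in> QC" using y c qclass_in_carrier by simp_all
    show "QL (cls c) Y" using Q_le_iff[OF c] y by blast
    assume "cls c = Y"
    then show False using qclass_eqD[OF c, of "c @ [y]"] y by simp
  next
    assume "\<exists>w\<in>QC. QL (cls c) w \<and> w \<noteq> cls c \<and> QL w Y \<and> w \<noteq> Y"
    then obtain W where W: "QL (cls c) W" "W \<noteq> cls c" "QL W Y" "W \<noteq> Y" by blast
    obtain e where e: "c @ e \<in> SC" "W = cls (c @ e)" using W(1) Q_le_iff[OF c] by blast
    obtain e' where e': "(c @ e) @ e' \<in> SC" "Y = cls ((c @ e) @ e')" using W(3) Q_le_iff[OF e(1)] e(2) by blast
    have "length ((c @ e) @ e') = length (c @ [y])" using qclass_eqD[OF e'(1)] e'(2) y(2) by metis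
    then have "length e + length e' = 1" by simp
    then have "e = [] \<or> e' = []" by (cases e) auto
    then show False using W e e' by auto
  qed
qed

lemma Q_le_bot: "X \<in> QC \<Longrightarrow> QL QB X"
proof -
  assume "X \<in> QC"
  then obtain c where c: "c \<in> SC" "X = cls c" by (rule Q_carrierE)
  then have "[z] @ tl c = c" using satchains_nonempty[of c] satchains_hd[of c] by (cases c) auto
  then show ?thesis
    unfolding Q_bot_def using Q_le_iff[OF satchains_singleton[OF bot_in]] c by metis
qed

lemma Q_maximal_iff:
  assumes c: "c \<in> SC"
  shows "is_maximal QC QL (cls c) \<longleftrightarrow> is_maximal A le (last c)"
proof
  assume max: "is_maximal QC QL (cls c)"
  show "is_maximal A le (last c)"
  proof (rule ccontr)
    assume "\<not> is_maximal A le (last c)"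
    then obtain w where "covers A le (last c) w"
      using satchains_last[OF c] ex_cover unfolding is_maximal_def by metis
    then have "c @ [w] \<in> SC" using c satchains_nonempty satchains_snoc_iff by metis
    then have "covers QC QL (cls c) (cls (c @ [w]))" using Q_covers_iff[OF c] by blast
    then show False using max unfolding covers_def is_maximal_def by blast
  qed
next
  assume max: "is_maximal A le (last c)"
  have "Y = cls c" if Y: "QL (cls c) Y" for Y
  proof -
    obtain e where e: "c @ e \<in> SC" "Y = cls (c @ e)" using Y Q_le_iff[OF c] by blast
    have "e = []"
    proof (cases e)
      case (Cons y e')
      then have "c @ [y] \<in> SC" using satchains_take[OF e(1), of "Suc (length c)"] by simp
      then have "covers A le (last c) y" using c satchains_nonempty satchains_snoc_iff by metis
      then show ?thesis using max unfolding covers_def is_maximal_def by blast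
    qed
    then show ?thesis using e by simp
  qed
  then show "is_maximal QC QL (cls c)" using qclass_in_carrier[OF c] unfolding is_maximal_def by metis
qed

text \<open>The inverse of \<open>phi\<close> on saturated chains from the bottom.\<close>

definition lift :: "'a list \<Rightarrow> 'a list set list" where
  "lift s = map (\<lambda>k. cls (take (Suc k) s)) [0..<length s]"

lemma length_lift: "length (lift s) = length s"
  by (simp add: lift_def)

lemma lift_snoc: "lift (s @ [y]) = lift s @ [cls (s @ [y])]"
  by (simp add: lift_def)

lemma last_lift: "s \<noteq> [] \<Longrightarrow> last (lift s) = cls s"
  by (cases s rule: rev_cases) (simp_all add: lift_snoc)

lemma take_lift: "take k (lift s) = lift (take k s)"
proof (rule nth_equalityI)
  fix i assume "i < length (take k (lift s))"
  then have "i < k" "i < length s" by (simp_all add: length_lift)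
  then show "take k (lift s) ! i = lift (take k s) ! i" by (simp add: lift_def min_def Suc_le_eq)
qed (simp add: lift_def)

lemma phi_lift: "s \<in> SC \<Longrightarrow> phi (lift s) = s"
proof (rule nth_equalityI)
  assume s: "s \<in> SC"
  show "length (phi (lift s)) = length s" by (simp add: phi_def lift_def)
  fix i assume "i < length (phi (lift s))"
  then have i: "i < length s" by (simp add: phi_def lift_def)
  have "take (Suc i) s \<in> SC" using s by (rule satchains_take) simp
  then have "qtop (cls (take (Suc i) s)) = s!i" using i by (simp add: qtop_qclass take_Suc_conv_app_nth)
  then show "phi (lift s) ! i = s ! i" using i by (simp add: phi_def lift_def)
qed

lemma inj_on_lift: "inj_on lift SC"
  using phi_lift by (metis inj_onI)

lemma lift_in_satchains: "s \<in> SC \<Longrightarrow> lift s \<in> satchains QC QL QB"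
proof (induction s rule: rev_induct)
  case Nil
  then show ?case by (simp add: satchains_def)
next
  case (snoc y s)
  show ?case
  proof (cases "s = []")
    case True
    then have "y = z" using satchains_hd[OF snoc.prems] by simp
    then have "lift (s @ [y]) = [QB]" using True by (simp add: lift_def Q_bot_def)
    moreover have "QB \<in> QC" unfolding Q_bot_def by (intro qclass_in_carrier satchains_singleton bot_in)
    ultimately show ?thesis by (simp add: satchains_singleton)
  next
    case False
    then have s: "s \<in> SC" using satchains_snoc_iff snoc.prems by metis
    have "covers QC QL (cls s) (cls (s @ [y]))" using Q_covers_iff[OF s] snoc.prems by blast
    moreover have "lift s \<noteq> []" using False by (simp add: lift_def)
    ultimately show ?thesis
      using snoc.IH[OF s] satchains_snoc_iff[of "lift s" "cls (s @ [y])" QC QL QB] False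
      by (simp add: lift_snoc last_lift)
  qed
qed

text \<open>If \<open>s\<close> represents the last class so far, the next cover appends one element
  to this very \<open>s\<close>. The representative thus grows along the chain, and its prefixes
  represent all the earlier classes.\<close>

lemma satchains_Q_imp_lift:
  assumes "S \<in> satchains QC QL QB"
  shows "\<exists>s\<in>SC. S = lift s"
  using assms
proof (induction S rule: rev_induct)
  case Nil
  then show ?case by (simp add: satchains_def)
next
  case (snoc Y S)
  show ?case
  proof (cases "S = []")
    case True
    then have "Y = QB" using satchains_hd[OF snoc.prems] by simp
    then have "S @ [Y] = lift [z]" using True by (simp add: lift_def Q_bot_def)
    then show ?thesis using satchains_singleton[OF bot_in] by blast
  next
    case False
    then have S: "S \<in> satchains QC QL QB" "covers QC QL (last S) Y"
      using satchains_snoc_iff[OF False, of Y QC QL QB] snoc.prems by simp_all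
    then obtain s where s: "s \<in> SC" "S = lift s" using snoc.IH by blast
    then obtain y where "s @ [y] \<in> SC" "Y = cls (s @ [y])"
      using S(2) Q_covers_iff[OF s(1)] satchains_nonempty[OF s(1)] by (auto simp: last_lift)
    then show ?thesis using s by (intro bexI[of _ "s @ [y]"]) (simp_all add: lift_snoc)
  qed
qed

lemma satchains_Q: "satchains QC QL QB = lift ` SC"
  using lift_in_satchains satchains_Q_imp_lift by (auto simp: image_iff)

lemma maxchains_Q: "maxchains QC QL QB = lift ` MC"
proof -
  have "is_maximal QC QL (last (lift s)) \<longleftrightarrow> is_maximal A le (last s)" if "s \<in> SC" for s
    using that by (simp add: last_lift Q_maximal_iff satchains_nonempty)
  then show ?thesis unfolding maxchains_def satchains_Q by auto
qed

lemma graded_Q: "graded_poset QC QL QB n"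
  unfolding graded_poset_def
proof (intro conjI ballI impI)
  show "finite QC" by (simp add: Q_carrier_def finite_satchains)
  show "QB \<in> QC" unfolding Q_bot_def by (intro qclass_in_carrier satchains_singleton bot_in)
  show "QL QB X" if "X \<in> QC" for X using that by (rule Q_le_bot)
  show "QL X X" if X: "X \<in> QC" for X
  proof -
    obtain c where c: "c \<in> SC" "X = cls c" using Q_carrierE[OF X] by metis
    then have "c @ [] \<in> SC" "X = cls (c @ [])" by simp_all
    then show ?thesis using c Q_le_iff by metis
  qed
  show "QL X W" if "QL X Y \<and> QL Y W" for X Y W
    using that unfolding Q_le_def by (meson trancl_trans)
  show "X = Y" if X: "X \<in> QC" and le: "QL X Y \<and> QL Y X" for X Y
  proof -
    obtain c where c: "c \<in> SC" "X = cls c" using Q_carrierE[OF X] by metis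
    obtain e where e: "c @ e \<in> SC" "Y = cls (c @ e)" using le c Q_le_iff by metis
    obtain e' where e': "(c @ e) @ e' \<in> SC" "X = cls ((c @ e) @ e')" using le e Q_le_iff by metis
    \<comment> \<open>Both lists represent the same class and so have equal length, which makes both
      tails empty.\<close>
    have "length c = length ((c @ e) @ e')" using qclass_eqD[OF c(1)] c(2) e'(2) by metis
    then show ?thesis using c e by simp
  qed
  show "length M = Suc n" if "M \<in> maxchains QC QL QB" for M
    using that length_maxchain unfolding maxchains_Q by (auto simp: length_lift)
qed

text \<open>Cancellation with lower root \<open>[z]\<close> and lower chain \<open>r\<close>
  confines an equivalence of two extensions of \<open>r\<close> to exchanges above \<open>r\<close>.
  It is stated for nontrivial intervals, hence the separate cases where \<open>r\<close> is
  \<open>[z]\<close> or all of \<open>s\<close>.\<close>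

lemma requiv_rooted_iff:
  assumes "r \<in> SC" "take (length r) s = r" "take (length r) s' = r" "s \<in> SC"
  shows "req [z] s s' \<longleftrightarrow> req r s s'"
proof
  assume "req r s s'"
  have "1 \<le> length r" using satchains_nonempty[OF assms(1)] by (simp add: Suc_le_eq)
  then have "raises r \<subseteq> raises [z]"
    using satchains_take_1[of _ A le z] unfolding raises_def by fastforce
  then have "raises r \<union> (raises r)\<inverse> \<subseteq> raises [z] \<union> (raises [z])\<inverse>" by blast
  then have "(s, s') \<in> (raises [z] \<union> (raises [z])\<inverse>)\<^sup>*"
    using \<open>req r s s'\<close> rtrancl_mono unfolding requiv_iff by blast
  then show "req [z] s s'" using satchains_take_1[OF assms(4)] assms(4) by (simp add: requiv_iff)
next
  assume req: "req [z] s s'"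
  have len: "length s' = length s" "last s' = last s" "s' \<in> SC" using requivD[OF req] by auto
  have le: "length r \<le> length s" using assms(2) by (metis length_take min.cobounded1)
  consider "length r = length s" | "length r = 1" | "1 < length r" "length r < length s"
    using le satchains_nonempty[OF assms(1)] by (metis One_nat_def le_neq_implies_less length_0_conv nat_neq_iff less_one)
  then show "req r s s'"
  proof cases
    case 1
    then have "take (length r) s = s" "take (length r) s' = s'" using len by simp_all
    then have "s = r" "s' = r" using assms(2,3) by metis+
    then show ?thesis using assms(1) by (simp add: requiv_refl)
  next
    case 2
    then have "r = [z]" using satchains_take_1[OF assms(1)] by simp
    then show ?thesis using req by simp
  next
    case 3
    have canc: "cancellative A le z lam" using gen_CW by (simp add: gen_CW_labeling_def)
    show ?thesis
      by (rule canc[unfolded cancellative_def, rule_format, of "[z]"])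
        (use 3 assms len req satchains_take_1[OF assms(1)] satchains_singleton[OF bot_in] in auto)
  qed
qed

lemma Fflag_Q:
  assumes "1 \<le> n"
  shows "Fflag QC QL QB \<alpha> = (\<Sum>m\<in>MC. Lfun {i \<in> {1..<n}. ascent lam m i} n \<alpha>)"
proof -
  interpret Q: graded QC QL QB n by (rule graded.intro) (rule graded_Q)
  \<comment> \<open>The distinguishing property on the quotient is the absence of an ascent in the
    underlying chain \<open>phi M\<close>; the violations, which index the fundamental functions,
    are then the ascents.\<close>
  have "Fflag QC QL QB \<alpha> = (\<Sum>M\<in>maxchains QC QL QB. Lfun {i \<in> {1..<n}. \<not> \<not> ascent slam (phi M) i} n \<alpha>)"
  proof (rule Q.Fflag_eq_sum_Lfun[OF assms])
    fix S i k assume S: "S \<in> satchains QC QL QB" "1 \<le> i" "Suc i < k" "k \<le> length S"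
    then obtain s where s: "s \<in> SC" "S = lift s" by (auto simp: satchains_Q)
    have "take k s \<in> SC" using s(1) S(3) by (intro satchains_take) auto
    then have "phi (take k S) = take k s" "phi S = s" using s by (simp_all add: take_lift phi_lift)
    then show "(\<not> ascent slam (phi (take k S)) i) = (\<not> ascent slam (phi S) i)"
      using ascent_take[OF s(1) S(3)] S(4) s by (simp add: length_lift)
  next
    fix R Y assume R: "R \<in> satchains QC QL QB" and "Y \<in> QC" and le: "QL (last R) Y"
    obtain r where r: "r \<in> SC" "R = lift r" using R by (auto simp: satchains_Q)
    have "last R = cls r" using r satchains_nonempty[OF r(1)] by (simp add: last_lift)
    then obtain e where e: "r @ e \<in> SC" "Y = cls (r @ e)" using le Q_le_iff[OF r(1)] by auto
    let ?P = "\<lambda>s. req r (r @ e) s \<and> (\<forall>i. length r \<le> i \<and> Suc i < length s \<longrightarrow> \<not> ascent slam s i)"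
    \<comment> \<open>Since \<open>lift\<close> is injective, agreement with the root of the
      quotient interval means that \<open>s\<close> extends \<open>r\<close>; the same top means
      equivalence from the bottom. Together they describe one class of the interval rooted at
      \<open>r\<close>.\<close>
    have iff: "take (length R) (lift s) = R \<and> last (lift s) = Y \<longleftrightarrow> req r (r @ e) s" if s: "s \<in> SC" for s
    proof -
      have "take (length R) (lift s) = R \<longleftrightarrow> take (length r) s = r"
      proof -
        have "take (length r) s \<in> SC" using s satchains_nonempty[OF r(1)] by (intro satchains_take) auto
        then show ?thesis using inj_on_eq_iff[OF inj_on_lift] r by (simp add: length_lift take_lift)
      qed
      moreover have "last (lift s) = Y \<longleftrightarrow> req [z] (r @ e) s"
        using qclass_eq_iff[OF e(1), of s] e(2) last_lift[OF satchains_nonempty[OF s]] by metis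
      ultimately show ?thesis
        using requiv_rooted_iff[OF r(1) _ _ e(1), of s] requivD(4)[of r "r @ e" s] by auto
    qed
    have "S \<in> satchains QC QL QB \<and> take (length R) S = R \<and> last S = Y \<and>
        (\<forall>i. length R \<le> i \<and> Suc i < length S \<longrightarrow> \<not> ascent slam (phi S) i) \<longleftrightarrow> (\<exists>s. S = lift s \<and> ?P s)" for S
    proof
      assume S: "S \<in> satchains QC QL QB \<and> take (length R) S = R \<and> last S = Y \<and>
        (\<forall>i. length R \<le> i \<and> Suc i < length S \<longrightarrow> \<not> ascent slam (phi S) i)"
      then obtain s where s: "s \<in> SC" "S = lift s" by (auto simp: satchains_Q)
      then show "\<exists>s. S = lift s \<and> ?P s"
        using S iff[OF s(1)] r by (intro exI[of _ s]) (auto simp: phi_lift length_lift)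
    next
      assume "\<exists>s. S = lift s \<and> ?P s"
      then obtain s where s: "S = lift s" "?P s" by blast
      then have "s \<in> SC" using requivD(2) by blast
      then show "S \<in> satchains QC QL QB \<and> take (length R) S = R \<and> last S = Y \<and>
        (\<forall>i. length R \<le> i \<and> Suc i < length S \<longrightarrow> \<not> ascent slam (phi S) i)"
        using s iff[of s] r lift_in_satchains by (auto simp: phi_lift length_lift)
    qed
    moreover have "\<exists>!s. ?P s" using ex1_ascent_free[OF e(1), of r] by simp
    ultimately show "\<exists>!S. S \<in> satchains QC QL QB \<and> take (length R) S = R \<and> last S = Y \<and>
        (\<forall>i. length R \<le> i \<and> Suc i < length S \<longrightarrow> \<not> ascent slam (phi S) i)"
      by auto
  qed
  also have "\<dots> = (\<Sum>m\<in>MC. Lfun {i \<in> {1..<n}. ascent slam (phi (lift m)) i} n \<alpha>)"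
  proof -
    have "inj_on lift MC" using inj_on_lift maxchain_satchain by (meson inj_on_subset subsetI)
    then show ?thesis unfolding maxchains_Q by (simp add: sum.reindex)
  qed
  also have "\<dots> = (\<Sum>m\<in>MC. Lfun {i \<in> {1..<n}. ascent lam m i} n \<alpha>)"
    by (intro sum.cong) (simp_all add: phi_lift maxchain_satchain ascent_slab_maxchain)
  finally show ?thesis .
qed

section \<open>The transported representation\<close>

lemma Uword_in_maxchains: "m \<in> MC \<Longrightarrow> Uword A le z lam ws m \<in> MC"
  by (induction ws) (simp_all add: Uword_def Umax_in_maxchains)

text \<open>On maximal chains the inverse of \<open>phi\<close> is \<open>lift\<close>, so each word
  acts on the quotient by a conjugate map, which has equally many fixed points.\<close>

lemma charQ_eq_charP: "charQ A le z lam = charP A le z lam"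
proof
  fix ws
  have phi_lift_max: "phi (lift m) = m" if "m \<in> MC" for m using that by (simp add: phi_lift maxchain_satchain)
  have inj: "inj_on phi (lift ` MC)" by (rule inj_onI) (auto simp: phi_lift_max)
  have inv: "inv_into (lift ` MC) phi m = lift m" if "m \<in> MC" for m
    using inv_into_f_f[OF inj, of "lift m"] that by (simp add: phi_lift_max)
  have inj_lift: "inj_on lift MC" using phi_lift_max by (metis inj_onI)
  have "{M \<in> lift ` MC. inv_into (lift ` MC) phi (Uword A le z lam ws (phi M)) = M} =
      lift ` {m \<in> MC. Uword A le z lam ws m = m}"
    using inj_on_eq_iff[OF inj_lift] Uword_in_maxchains by (auto simp: phi_lift_max inv)
  moreover have "card (lift ` {m \<in> MC. Uword A le z lam ws m = m}) = card {m \<in> MC. Uword A le z lam ws m = m}"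
    by (rule card_image, rule inj_on_subset[OF inj_lift]) auto
  ultimately show "charQ A le z lam ws = charP A le z lam ws"
    by (simp add: charQ_def charP_def maxchains_Q Let_def)
qed

end

text \<open>The condition \<open>1 \<le> n\<close> excludes the one-point poset: there the strict
  last step makes the flag function 0, while the characteristic is the constant 1.\<close>

theorem theorem1p8:
  fixes A :: "'a set" and le :: "'a \<Rightarrow> 'a \<Rightarrow> bool" and z :: 'a and n :: nat
    and lam :: "'a list \<Rightarrow> nat \<Rightarrow> 'l::order"
  assumes "graded_poset A le z n" and "1 \<le> n" and "gen_CW_labeling A le z lam"
  shows "qch n (charQ A le z lam) = qch n (charP A le z lam) \<and>
         qch n (charP A le z lam) = Fflag A le z \<and>
         Fflag A le z = omega n (Fflag (Q_carrier A le z lam) (Q_le A le z lam) (Q_bot A le z lam))"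
proof -
  interpret gen_CW A le z n lam
    by (intro gen_CW.intro graded.intro gen_CW_axioms.intro assms)
  have P: "Fflag A le z = (\<lambda>\<alpha>. \<Sum>m\<in>MC. Lfun {i \<in> {1..<n}. \<not> ascent lam m i} n \<alpha>)"
    using Fflag_P[OF assms(2)] by blast
  have "Fflag QC QL QB = (\<lambda>\<alpha>. \<Sum>m\<in>MC. Lfun {i \<in> {1..<n}. ascent lam m i} n \<alpha>)"
    using Fflag_Q[OF assms(2)] by blast
  then have "omega n (Fflag QC QL QB) =
      (\<lambda>\<alpha>. \<Sum>m\<in>MC. Lfun ({1..<n} - {i \<in> {1..<n}. ascent lam m i}) n \<alpha>)"
    by (simp only:) (rule omega_sum_Lfun[OF finite_maxchains], blast)
  moreover have "{1..<n} - {i \<in> {1..<n}. ascent lam m i} = {i \<in> {1..<n}. \<not> ascent lam m i}" for m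
    by blast
  ultimately have "omega n (Fflag QC QL QB) = Fflag A le z" by (simp only: P)
  then show ?thesis using qch_charP P charQ_eq_charP by simp
qed

end
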